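(* Let $G$ be a finitely generated LERF group and let $H\le G$ be finitely generated. (i) $H$ is profinitely rigid in $G$ if and only if, for every $\Theta\in\mathrm{Aut}(\widehat G)$ satisfying $\Theta(H)\le G$, there exists $\varphi\in\mathrm{Aut}(G)$ such that $\varphi|_H=\Theta|_H$. (ii) $H$ is setwise profinitely rigid in $G$ if and only if, for every $\Theta\in\mathrm{Aut}(\widehat G)$ satisfying $\Theta(H)\le G$, one has $\Theta(H)\in\mathrm{Aut}(G)\cdot H$, i.e. $\Theta(H)=\varphi(H)$ for some $\varphi\in\mathrm{Aut}(G)$.
   Context: A group $G$ is LERF (subgroup separable) if for every finitely generated subgroup $H\le G$ and every $g\in G\setminus H$ there is a finite-index normal subgroup $N$ of $G$ with $gN\notin HN/N$; in particular $G$ is residually finite and is regarded as a subgroup of its profinite completion $\widehat G$. $\mathrm{Aut}(\widehat G)$ is the group of continuous automorphisms. For a finite group $K$, a finitely generated $H\le G$ and $h\in\mathrm{Hom}(H,K)$, put $\Pr_{H,K}(h)=|\{f\in\mathrm{Hom}(G,K): f|_H=h\}|/|\mathrm{Hom}(G,K)|$. An isomorphism $\alpha\colon H_1\to H_2$ between finitely generated subgroups of $G$ is a measure equivalence if $\Pr_{H_2,K}(h)=\Pr_{H_1,K}(h\circ\alpha)$ for every finite group $K$ and every $h\in\mathrm{Hom}(H_2,K)$; $H_1,H_2$ are measure equivalent if such an $\alpha$ exists. $H$ is profinitely rigid in $G$ if, whenever $L\le G$ is finitely generated and $\alpha\colon H\to L$ is a measure equivalence, there exists $\varphi\in\mathrm{Aut}(G)$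 with $\varphi(H)=L$ and $\varphi|_H=\alpha$. $H$ is setwise profinitely rigid in $G$ if every finitely generated $L\le G$ measure equivalent to $H$ is of the form $L=\varphi(H)$ for some $\varphi\in\mathrm{Aut}(G)$. *)

theory Defs
  imports
    "HOL-Algebra.Bij"
    "HOL-Algebra.Generated_Groups"
    "HOL-Algebra.Product_Groups"
    "HOL-Analysis.Function_Topology"
begin

definition fg_subgroup :: "('a, 'b) monoid_scheme \<Rightarrow> 'a set \<Rightarrow> bool" where
  "fg_subgroup G H \<longleftrightarrow> (\<exists>S. finite S \<and> S \<subseteq> carrier G \<and> H = generate G S)"

definition finite_index_normal :: "('a, 'b) monoid_scheme \<Rightarrow> 'a set set" where
  "finite_index_normal G = {N. N \<lhd> G \<and> finite (rcosets\<^bsub>G\<^esub> N)}"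

text \<open>
  In the next definition the last set is the group \<open>HN/N\<close>, i.e. the cosets of \<open>N\<close> in \<open>HN\<close>.
  Left and right cosets of \<open>N\<close> agree; right cosets are used throughout because they are the
  elements of \<^term>\<open>G Mod N\<close>.
\<close>

definition LERF :: "('a, 'b) monoid_scheme \<Rightarrow> bool" where
  "LERF G \<longleftrightarrow>
     (\<forall>H. fg_subgroup G H \<longrightarrow>
        (\<forall>g \<in> carrier G - H. \<exists>N \<in> finite_index_normal G.
           N #>\<^bsub>G\<^esub> g \<notin> rcosets\<^bsub>G\<lparr>carrier := H <#>\<^bsub>G\<^esub> N\<rparr>\<^esub> N))"

text \<open>
  The inverse limit of the finite quotients \<open>G/N\<close>. For \<open>N \<subseteq> M\<close> the canonical map
  \<open>G/N \<rightarrow> G/M\<close> sends a coset \<open>C\<close> of \<open>N\<close> to \<open>MC\<close>.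
\<close>

definition profinite_completion :: "('a, 'b) monoid_scheme \<Rightarrow> ('a set \<Rightarrow> 'a set) monoid" where
  "profinite_completion G =
     (product_group (finite_index_normal G) (\<lambda>N. G Mod N))
       \<lparr>carrier := {x \<in> carrier (product_group (finite_index_normal G) (\<lambda>N. G Mod N)).
          \<forall>N \<in> finite_index_normal G. \<forall>M \<in> finite_index_normal G.
            N \<subseteq> M \<longrightarrow> M <#>\<^bsub>G\<^esub> x N = x M}\<rparr>"

definition profinite_topology :: "('a, 'b) monoid_scheme \<Rightarrow> ('a set \<Rightarrow> 'a set) topology" where
  "profinite_topology G =
     subtopology
       (product_topology (\<lambda>N. discrete_topology (carrier (G Mod N))) (finite_index_normal G))
       (carrier (profinite_completion G))"

definition to_completion :: "('a, 'b) monoid_scheme \<Rightarrow> 'a \<Rightarrow> ('a set \<Rightarrow> 'a set)" where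
  "to_completion G g = (\<lambda>N \<in> finite_index_normal G. N #>\<^bsub>G\<^esub> g)"

definition continuous_auto ::
  "('a, 'b) monoid_scheme \<Rightarrow> (('a set \<Rightarrow> 'a set) \<Rightarrow> ('a set \<Rightarrow> 'a set)) set" where
  "continuous_auto G =
     {\<Theta> \<in> auto (profinite_completion G).
        continuous_map (profinite_topology G) (profinite_topology G) \<Theta>}"

text \<open>
  Unlike \<^const>\<open>hom\<close>, the following set contains each homomorphism exactly once, so that it can
  be counted.
\<close>

definition Hom :: "('a, 'b) monoid_scheme \<Rightarrow> ('c, 'd) monoid_scheme \<Rightarrow> ('a \<Rightarrow> 'c) set" where
  "Hom G K = hom G K \<inter> extensional (carrier G)"

definition Pr ::
  "('a, 'b) monoid_scheme \<Rightarrow> 'a set \<Rightarrow> ('c, 'd) monoid_scheme \<Rightarrow> ('a \<Rightarrow> 'c) \<Rightarrow> real" where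
  "Pr G H K h = real (card {f \<in> Hom G K. restrict f H = h}) / real (card (Hom G K))"

text \<open>
  Every finite group is isomorphic to one whose elements are natural numbers, so nothing is lost
  by letting \<open>K\<close> range over \<^typ>\<open>nat monoid\<close>; see \<open>measure_equivalence_finite_group\<close> below.
\<close>

definition measure_equivalence ::
  "('a, 'b) monoid_scheme \<Rightarrow> 'a set \<Rightarrow> 'a set \<Rightarrow> ('a \<Rightarrow> 'a) \<Rightarrow> bool" where
  "measure_equivalence G H\<^sub>1 H\<^sub>2 \<alpha> \<longleftrightarrow>
     fg_subgroup G H\<^sub>1 \<and> fg_subgroup G H\<^sub>2 \<and>
     \<alpha> \<in> iso (G\<lparr>carrier := H\<^sub>1\<rparr>) (G\<lparr>carrier := H\<^sub>2\<rparr>) \<and>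
     (\<forall>K :: nat monoid. group K \<and> finite (carrier K) \<longrightarrow>
        (\<forall>h \<in> Hom (G\<lparr>carrier := H\<^sub>2\<rparr>) K. Pr G H\<^sub>2 K h = Pr G H\<^sub>1 K (compose H\<^sub>1 h \<alpha>)))"

definition measure_equivalent :: "('a, 'b) monoid_scheme \<Rightarrow> 'a set \<Rightarrow> 'a set \<Rightarrow> bool" where
  "measure_equivalent G H\<^sub>1 H\<^sub>2 \<longleftrightarrow> (\<exists>\<alpha>. measure_equivalence G H\<^sub>1 H\<^sub>2 \<alpha>)"

definition profinitely_rigid :: "('a, 'b) monoid_scheme \<Rightarrow> 'a set \<Rightarrow> bool" where
  "profinitely_rigid G H \<longleftrightarrow>
     (\<forall>L \<alpha>. fg_subgroup G L \<and> measure_equivalence G H L \<alpha> \<longrightarrow>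
        (\<exists>\<phi> \<in> auto G. \<phi> ` H = L \<and> (\<forall>h \<in> H. \<phi> h = \<alpha> h)))"

definition setwise_profinitely_rigid :: "('a, 'b) monoid_scheme \<Rightarrow> 'a set \<Rightarrow> bool" where
  "setwise_profinitely_rigid G H \<longleftrightarrow>
     (\<forall>L. fg_subgroup G L \<and> measure_equivalent G H L \<longrightarrow> (\<exists>\<phi> \<in> auto G. L = \<phi> ` H))"

lemma Pr_transfer:
  assumes K: "group K" and K': "group K'" and G: "group G" and H: "H \<subseteq> carrier G"
    and i: "i \<in> iso K K'" and h: "h \<in> H \<rightarrow>\<^sub>E carrier K"
  shows "Pr G H K' (compose H i h) = Pr G H K h"
proof -
  have inj: "inj_on i (carrier K)" and bij: "bij_betw i (carrier K) (carrier K')"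
    and ih: "i \<in> hom K K'"
    using i by (auto simp: iso_def bij_betw_def)
  define j where "j = inv_into (carrier K) i"
  have jh: "j \<in> hom K' K"
    using group.iso_set_sym[OF K i] by (simp add: iso_def j_def)
  have ij: "i (j y) = y" if "y \<in> carrier K'" for y
    using bij that by (auto simp: j_def bij_betw_def f_inv_into_f)
  have ji: "j (i x) = x" if "x \<in> carrier K" for x
    using inj that by (simp add: j_def)
  have b: "bij_betw (compose (carrier G) i) (Hom G K) (Hom G K')"
    by (rule bij_betw_byWitness[where f' = "compose (carrier G) j"])
       (use ih jh in \<open>auto simp: Hom_def hom_def compose_def ij ji Pi_iff extensional_def fun_eq_iff
          group.is_monoid[OF G] monoid.m_closed\<close>)
  have eq: "restrict (compose (carrier G) i f) H = compose H i h \<longleftrightarrow> restrict f H = h"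
    if f: "f \<in> Hom G K" for f
  proof -
    have "i (f x) = i (h x) \<longleftrightarrow> f x = h x" if "x \<in> H" for x
      using f h H that inj by (auto simp: Hom_def hom_def inj_on_eq_iff Pi_iff PiE_iff subset_iff)
    moreover have "h x = undefined" if "x \<notin> H" for x
      using h that by (auto simp: PiE_iff extensional_def)
    ultimately show ?thesis
      using H by (auto simp: compose_def restrict_def fun_eq_iff subset_iff)
  qed
  have "bij_betw (compose (carrier G) i) {f \<in> Hom G K. restrict f H = h}
          {f \<in> Hom G K'. restrict f H = compose H i h}"
  proof (rule bij_betw_subset[OF b])
    show "{f \<in> Hom G K. restrict f H = h} \<subseteq> Hom G K"
      by simp
    have "Hom G K' = compose (carrier G) i ` Hom G K"
      using b by (simp add: bij_betw_def)
    then show "compose (carrier G) i ` {f \<in> Hom G K. restrict f H = h}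
            = {f \<in> Hom G K'. restrict f H = compose H i h}"
      using eq by (simp add: set_eq_iff image_iff Bex_def) metis
  qed
  then show ?thesis
    using b by (simp add: Pr_def bij_betw_same_card)
qed

lemma measure_equivalence_finite_group:
  fixes K :: "('c, 'd) monoid_scheme"
  assumes G: "group G" and \<alpha>: "measure_equivalence G H\<^sub>1 H\<^sub>2 \<alpha>"
    and K: "group K" and fin: "finite (carrier K)" and h: "h \<in> Hom (G\<lparr>carrier := H\<^sub>2\<rparr>) K"
  shows "Pr G H\<^sub>2 K h = Pr G H\<^sub>1 K (compose H\<^sub>1 h \<alpha>)"
proof -
  obtain i :: "'c \<Rightarrow> nat" where i: "inj_on i (carrier K)"
    using finite_imp_inj_to_nat_seg[OF fin] by blast
  define j where "j = inv_into (carrier K) i"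
  define K' :: "nat monoid" where
    "K' = \<lparr>carrier = i ` carrier K, mult = \<lambda>x y. i (j x \<otimes>\<^bsub>K\<^esub> j y), one = i \<one>\<^bsub>K\<^esub>\<rparr>"
  have iso: "i \<in> iso K K'"
    using i by (auto simp: iso_def hom_def K'_def bij_betw_def j_def)
  have K': "group K'"
    using group.iso_imp_img_group[OF K iso] by (simp add: K'_def)
  have H: "H\<^sub>1 \<subseteq> carrier G" "H\<^sub>2 \<subseteq> carrier G"
    using \<alpha> group.generate_incl[OF G] by (auto simp: measure_equivalence_def fg_subgroup_def)
  have a: "\<alpha> \<in> H\<^sub>1 \<rightarrow> H\<^sub>2"
    using \<alpha> by (auto simp: measure_equivalence_def iso_def hom_def)
  have hE: "h \<in> H\<^sub>2 \<rightarrow>\<^sub>E carrier K"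
    using h by (auto simp: Hom_def hom_def PiE_def)
  have haE: "compose H\<^sub>1 h \<alpha> \<in> H\<^sub>1 \<rightarrow>\<^sub>E carrier K"
    using a hE by (auto simp: compose_def)
  have sub2: "subgroup H\<^sub>2 G"
    using \<alpha> group.generate_is_subgroup[OF G] by (auto simp: measure_equivalence_def fg_subgroup_def)
  have ihh: "compose H\<^sub>2 i h \<in> Hom (G\<lparr>carrier := H\<^sub>2\<rparr>) K'"
    using h iso subgroup.m_closed[OF sub2]
    by (auto simp: Hom_def hom_def iso_def compose_def Pi_iff)
  have "Pr G H\<^sub>2 K h = Pr G H\<^sub>2 K' (compose H\<^sub>2 i h)"
    using Pr_transfer[OF K K' G H(2) iso hE] by simp
  also have "\<dots> = Pr G H\<^sub>1 K' (compose H\<^sub>1 (compose H\<^sub>2 i h) \<alpha>)"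
    using \<alpha> ihh K' fin unfolding measure_equivalence_def by (auto simp: K'_def)
  also have "compose H\<^sub>1 (compose H\<^sub>2 i h) \<alpha> = compose H\<^sub>1 i (compose H\<^sub>1 h \<alpha>)"
    using a by (auto simp: compose_def fun_eq_iff)
  also have "Pr G H\<^sub>1 K' \<dots> = Pr G H\<^sub>1 K (compose H\<^sub>1 h \<alpha>)"
    by (rule Pr_transfer[OF K K' G H(1) iso haE])
  finally show ?thesis .
qed

lemma to_completion_in_carrier:
  assumes G: "group G" and g: "g \<in> carrier G"
  shows "to_completion G g \<in> carrier (profinite_completion G)"
proof -
  interpret group G by (rule G)
  have "M <#>\<^bsub>G\<^esub> (N #>\<^bsub>G\<^esub> g) = M #>\<^bsub>G\<^esub> g"
    if "N \<lhd> G" "M \<lhd> G" "N \<subseteq> M" for N M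
  proof -
    have N: "subgroup N G" and M: "subgroup M G"
      using that by (auto intro: normal_imp_subgroup)
    have "M <#>\<^bsub>G\<^esub> (N #>\<^bsub>G\<^esub> g) = (M <#>\<^bsub>G\<^esub> N) #>\<^bsub>G\<^esub> g"
      using setmult_rcos_assoc[OF subgroup.subset[OF M] subgroup.subset[OF N] g] by simp
    also have "M <#>\<^bsub>G\<^esub> N = M"
    proof
      show "M <#>\<^bsub>G\<^esub> N \<subseteq> M"
        using \<open>N \<subseteq> M\<close> subgroup.m_closed[OF M] by (auto simp: set_mult_def)
      show "M \<subseteq> M <#>\<^bsub>G\<^esub> N"
      proof
        fix x assume "x \<in> M"
        then have "x = x \<otimes>\<^bsub>G\<^esub> \<one>\<^bsub>G\<^esub>"
          using subgroup.mem_carrier[OF M] by simp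
        then show "x \<in> M <#>\<^bsub>G\<^esub> N"
          using \<open>x \<in> M\<close> subgroup.one_closed[OF N] unfolding set_mult_def by blast
      qed
    qed
    finally show ?thesis .
  qed
  then show ?thesis
    using g by (auto simp: profinite_completion_def to_completion_def finite_index_normal_def
        FactGroup_def intro!: rcosetsI normal_imp_subgroup subgroup.subset)
qed

lemma to_completion_hom:
  assumes G: "group G"
  shows "to_completion G \<in> hom G (profinite_completion G)"
proof -
  interpret group G by (rule G)
  show ?thesis
    by (rule homI)
       (auto simp: to_completion_in_carrier[OF G],
        auto simp: profinite_completion_def to_completion_def product_group_def FactGroup_def
          finite_index_normal_def fun_eq_iff restrict_def normal.rcos_sum)
qed

lemma inj_on_to_completion:
  assumes G: "group G" and lerf: "LERF G"
  shows "inj_on (to_completion G) (carrier G)"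
proof -
  interpret group G by (rule G)
  interpret c: group_hom G "product_group (finite_index_normal G) (\<lambda>N. G Mod N)" "to_completion G"
  proof -
    have "to_completion G \<in> hom G (product_group (finite_index_normal G) (\<lambda>N. G Mod N))"
      using to_completion_hom[OF G] by (auto simp: hom_def profinite_completion_def)
    moreover have "group (product_group (finite_index_normal G) (\<lambda>N. G Mod N))"
      by (rule product_group) (auto simp: finite_index_normal_def normal.factorgroup_is_group)
    ultimately show "group_hom G (product_group (finite_index_normal G) (\<lambda>N. G Mod N)) (to_completion G)"
      using G by (simp add: group_hom_def group_hom_axioms_def)
  qed
  show ?thesis
  proof (rule c.inj_iff_trivial_ker[THEN iffD2])
    show "kernel G (product_group (finite_index_normal G) (\<lambda>N. G Mod N)) (to_completion G) = {\<one>\<^bsub>G\<^esub>}"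
    proof (rule ccontr)
      assume "\<not> ?thesis"
      then obtain g where g: "g \<in> carrier G" "g \<noteq> \<one>\<^bsub>G\<^esub>"
        "to_completion G g = \<one>\<^bsub>product_group (finite_index_normal G) (\<lambda>N. G Mod N)\<^esub>"
        using c.hom_one by (force simp: kernel_def simp del: one_product_group)
      have "fg_subgroup G {\<one>\<^bsub>G\<^esub>}"
        unfolding fg_subgroup_def by (intro exI[of _ "{}"]) (simp add: generate_empty)
      then obtain N where N: "N \<in> finite_index_normal G"
        and n: "N #>\<^bsub>G\<^esub> g \<notin> rcosets\<^bsub>G\<lparr>carrier := {\<one>\<^bsub>G\<^esub>} <#>\<^bsub>G\<^esub> N\<rparr>\<^esub> N"
        using lerf g unfolding LERF_def by blast
      have sub: "subgroup N G"
        using N by (auto simp: finite_index_normal_def intro: normal_imp_subgroup)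
      have "N #>\<^bsub>G\<^esub> g = N"
        using fun_cong[OF g(3), of N] N by (simp add: to_completion_def product_group_def FactGroup_def)
      moreover have "N \<in> rcosets\<^bsub>G\<lparr>carrier := {\<one>\<^bsub>G\<^esub>} <#>\<^bsub>G\<^esub> N\<rparr>\<^esub> N"
        using subgroup.one_closed[OF sub] subgroup.mem_carrier[OF sub]
        by (force simp: RCOSETS_def set_mult_def r_coset_def)
      ultimately show False using n by simp
    qed
  qed
qed

end

theory Submission
  imports Defs "HOL-Analysis.Abstract_Topological_Spaces"
begin

text \<open>
  Measure equivalences between finitely generated subgroups of \<open>G\<close> are the same as restrictions of
  continuous automorphisms of the completion. Given this, both equivalences are a matter of
  comparing definitions, because \<open>G\<close> embeds into its completion when it is LERF.

  If \<open>\<Theta>\<close> is a continuous automorphism that maps \<open>H\<close> into \<open>G\<close>, then precomposition with \<open>\<Theta>\<close> permutes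
  the homomorphisms from \<open>G\<close> to a finite group \<open>K\<close>, since these are the continuous homomorphisms from
  the completion to \<open>K\<close>. The permutation matches those that restrict to \<open>h\<close> on the image of \<open>H\<close> with
  those that restrict on \<open>H\<close> to \<open>h\<close> composed with \<open>\<Theta>\<close>
  (\<open>continuous_auto_restricts_to_measure_equivalence\<close>).

  Conversely, let \<open>\<alpha>\<close> be a measure equivalence from \<open>H\<close> to \<open>L\<close>. Induction over the subgroups of \<open>K\<close>
  turns the equality of the numbers of homomorphisms extending \<open>h\<close> and \<open>h \<circ> \<alpha>\<close> into the same equality
  for epimorphisms (\<open>measure_equivalence_card_image\<close>). Applied to the projection onto a finite
  quotient, it yields an epimorphism from \<open>G\<close> onto that quotient which on \<open>H\<close> is \<open>\<alpha>\<close> followed by the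
  projection (\<open>measure_equivalence_epi\<close>). Each quotient has finitely many of these, so by compactness
  they can be chosen compatibly (\<open>finite_inverse_limit_nonempty\<close>). The choices assemble to a
  continuous endomorphism of the completion that agrees with \<open>\<alpha>\<close> on \<open>H\<close>. It is bijective because
  cofinally many finite-index normal subgroups \<open>N\<close> are the kernel of every epimorphism onto the quotient by \<open>N\<close>
  (\<open>exists_normal_with_unique_epi_kernel\<close>, \<open>coherent_epis_induce_continuous_auto\<close>).
\<close>

section \<open>Normal subgroups of finite index\<close>

context group
begin

lemma finite_index_normalD:
  assumes "N \<in> finite_index_normal G"
  shows "N \<lhd> G" and "subgroup N G"
  using assms by (auto simp: finite_index_normal_def intro: normal_imp_subgroup)

lemma rcoset_eq_iff:
  assumes "subgroup N G" "a \<in> carrier G" "b \<in> carrier G"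
  shows "N #> a = N #> b \<longleftrightarrow> a \<in> N #> b"
  using assms repr_independence rcos_self by metis

lemma set_mult_rcoset:
  assumes "subgroup N G" "subgroup M G" "N \<subseteq> M" "g \<in> carrier G"
  shows "M <#> (N #> g) = M #> g"
proof -
  have "M <#> N = M"
  proof
    show "M <#> N \<subseteq> M"
      using \<open>N \<subseteq> M\<close> subgroup.m_closed[OF assms(2)] by (auto simp: set_mult_def)
    show "M \<subseteq> M <#> N"
    proof
      fix x assume "x \<in> M"
      then have "x = x \<otimes> \<one>"
        using subgroup.mem_carrier[OF assms(2)] by simp
      then show "x \<in> M <#> N"
        using \<open>x \<in> M\<close> subgroup.one_closed[OF assms(1)] unfolding set_mult_def by blast
    qed
  qed
  then show ?thesis
    using setmult_rcos_assoc[OF subgroup.subset[OF assms(2)] subgroup.subset[OF assms(1)] assms(4)]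
    by simp
qed

text \<open>
  The index of \<open>N\<close> is bounded through any map \<open>\<phi>\<close> with finite image whose fibres lie in cosets
  of \<open>N\<close>: the coset of \<open>g\<close> can be recovered from \<open>\<phi> g\<close>.
\<close>

lemma finite_index_normalI:
  assumes N: "N \<lhd> G" and fin: "finite (\<phi> ` carrier G)"
    and eq: "\<And>g g'. g \<in> carrier G \<Longrightarrow> g' \<in> carrier G \<Longrightarrow> \<phi> g = \<phi> g' \<Longrightarrow> N #> g = N #> g'"
  shows "N \<in> finite_index_normal G"
proof -
  have "rcosets N \<subseteq> (\<lambda>k. N #> (SOME g. g \<in> carrier G \<and> \<phi> g = k)) ` \<phi> ` carrier G"
  proof
    fix C assume "C \<in> rcosets N"
    then obtain g where g: "g \<in> carrier G" "C = N #> g"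
      by (auto simp: RCOSETS_def)
    define g' where "g' = (SOME g'. g' \<in> carrier G \<and> \<phi> g' = \<phi> g)"
    have "g' \<in> carrier G \<and> \<phi> g' = \<phi> g"
      unfolding g'_def by (rule someI[of _ g]) (use g in simp)
    then have "C = N #> g'" using eq g by metis
    then show "C \<in> (\<lambda>k. N #> (SOME g. g \<in> carrier G \<and> \<phi> g = k)) ` \<phi> ` carrier G"
      using g unfolding g'_def by blast
  qed
  then have "finite (rcosets N)"
    using fin by (meson finite_imageI finite_subset)
  with N show ?thesis by (simp add: finite_index_normal_def)
qed

lemma carrier_finite_index_normal: "carrier G \<in> finite_index_normal G"
proof (rule finite_index_normalI[where \<phi> = "\<lambda>_. ()"])
  show "carrier G \<lhd> G"
    by (simp add: normal_self)
qed (auto simp: coset_join2 subgroup_self)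

lemma Int_finite_index_normal:
  assumes N: "N \<in> finite_index_normal G" and M: "M \<in> finite_index_normal G"
  shows "N \<inter> M \<in> finite_index_normal G"
proof (rule finite_index_normalI[where \<phi> = "\<lambda>g. (N #> g, M #> g)"])
  note n = finite_index_normalD[OF N] and m = finite_index_normalD[OF M]
  show nm: "N \<inter> M \<lhd> G"
    using n m by (simp add: normal_inv_iff subgroups_Inter_pair)
  have "(\<lambda>g. (N #> g, M #> g)) ` carrier G \<subseteq> (rcosets N) \<times> (rcosets M)"
    by (auto simp: RCOSETS_def)
  then show "finite ((\<lambda>g. (N #> g, M #> g)) ` carrier G)"
    using N M by (auto simp: finite_index_normal_def intro: finite_subset)
  fix g g' assume g: "g \<in> carrier G" "g' \<in> carrier G" and "(N #> g, M #> g) = (N #> g', M #> g')"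
  then have "g \<in> N #> g'" "g \<in> M #> g'"
    using n m by (auto simp: rcoset_eq_iff)
  then have "g \<in> (N \<inter> M) #> g'"
    using g n m normal_imp_subgroup[OF nm] by (simp add: subgroup.rcos_module is_group)
  then show "N \<inter> M #> g = N \<inter> M #> g'"
    using g normal_imp_subgroup[OF nm] by (simp add: rcoset_eq_iff)
qed

lemma Inter_finite_index_normal:
  assumes "finite F" "F \<subseteq> finite_index_normal G"
  shows "\<Inter>F \<inter> carrier G \<in> finite_index_normal G"
  using assms
proof (induction F rule: finite_induct)
  case empty
  then show ?case by (simp add: carrier_finite_index_normal)
next
  case (insert N F)
  then show ?case
    using Int_finite_index_normal[of N "\<Inter>F \<inter> carrier G"] by (simp add: Int_assoc)
qed

lemma group_homI: "group K \<Longrightarrow> f \<in> hom G K \<Longrightarrow> group_hom G K f"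
  by (simp add: group_hom_def group_hom_axioms_def is_group)

lemma hom_eq_imp_kernel:
  assumes "group K" "f \<in> hom G K" "a \<in> carrier G" "b \<in> carrier G" "f a = f b"
  shows "a \<otimes> inv b \<in> kernel G K f"
proof -
  interpret f: group_hom G K f by (rule group_homI[OF assms(1,2)])
  show ?thesis using assms(3-5) by (simp add: kernel_def)
qed

lemma kernel_finite_index_normal:
  assumes K: "group K" "finite (carrier K)" and f: "f \<in> hom G K"
  shows "kernel G K f \<in> finite_index_normal G"
proof (rule finite_index_normalI[where \<phi> = f])
  interpret f: group_hom G K f using group_homI K f by blast
  show "kernel G K f \<lhd> G" by (rule f.normal_kernel)
  show "finite (f ` carrier G)"
    using K(2) by (rule finite_subset[rotated]) auto
  fix g g' assume g: "g \<in> carrier G" "g' \<in> carrier G" "f g = f g'"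
  then have "g \<otimes> inv g' \<in> kernel G K f"
    by (intro hom_eq_imp_kernel[OF K(1) f])
  then have "g \<in> kernel G K f #> g'"
    using g f.subgroup_kernel by (simp add: subgroup.rcos_module is_group)
  then show "kernel G K f #> g = kernel G K f #> g'"
    using g f.subgroup_kernel by (simp add: rcoset_eq_iff)
qed

lemma hom_cong_kernel:
  assumes K: "group K" and f: "f \<in> hom G K" and N: "subgroup N G" "N \<subseteq> kernel G K f"
    and g: "a \<in> carrier G" "b \<in> carrier G" "N #> a = N #> b"
  shows "f a = f b"
proof -
  interpret f: group_hom G K f using group_homI K f by blast
  have "a \<otimes> inv b \<in> N"
    using g N by (metis rcoset_eq_iff subgroup.rcos_module is_group)
  then have "f (a \<otimes> inv b) = \<one>\<^bsub>K\<^esub>" using N by (auto simp: kernel_def)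
  then have "f a \<otimes>\<^bsub>K\<^esub> inv\<^bsub>K\<^esub> f b = \<one>\<^bsub>K\<^esub>" using g by simp
  then show ?thesis
    using g by (metis f.H.inv_equality f.H.inv_inv f.hom_closed f.H.inv_closed)
qed

lemma finite_Mod:
  assumes "N \<in> finite_index_normal G"
  shows "group (G Mod N)" "finite (carrier (G Mod N))"
proof -
  show "group (G Mod N)"
    using normal.factorgroup_is_group[OF finite_index_normalD(1)[OF assms]] .
  show "finite (carrier (G Mod N))"
    using assms by (simp add: finite_index_normal_def FactGroup_def)
qed

section \<open>Elements of the completion\<close>

text \<open>
  A coordinate of a point of the completion is a coset, and calculations are done with group
  elements lying in it. A representative at a small normal subgroup is a representative at every
  larger one, so finitely many coordinates can always be represented by a single element of \<open>G\<close>,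
  taken at the intersection of the subgroups.
\<close>

lemma completion_coset:
  assumes "x \<in> carrier (profinite_completion G)" "N \<in> finite_index_normal G"
  obtains g where "g \<in> carrier G" "x N = N #> g" "g \<in> x N"
proof -
  have "x N \<in> rcosets N"
    using assms by (auto simp: profinite_completion_def FactGroup_def)
  then obtain g where "g \<in> carrier G" "x N = N #> g" by (auto simp: RCOSETS_def)
  then show ?thesis using that assms rcos_self finite_index_normalD by metis
qed

lemma completion_repr:
  assumes "x \<in> carrier (profinite_completion G)" "N \<in> finite_index_normal G" "g \<in> x N"
  shows "g \<in> carrier G" "x N = N #> g"
proof -
  obtain a where a: "a \<in> carrier G" "x N = N #> a" using completion_coset assms by metis
  then show "g \<in> carrier G" "x N = N #> g"
    using assms finite_index_normalD(2)[OF assms(2)]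
    by (metis r_coset_subset_G subgroup.subset subsetD, metis repr_independence)
qed

lemma completion_mono:
  assumes "x \<in> carrier (profinite_completion G)" "N \<in> finite_index_normal G" "g \<in> x N"
    and "M \<in> finite_index_normal G" "N \<subseteq> M"
  shows "g \<in> x M"
proof -
  note g = completion_repr[OF assms(1,2,3)]
  have "M <#> x N = x M" using assms by (auto simp: profinite_completion_def)
  then have "x M = M #> g"
    using g assms finite_index_normalD by (simp add: set_mult_rcoset)
  then show ?thesis using g rcos_self finite_index_normalD(2)[OF assms(4)] by simp
qed

lemma completionI:
  assumes "x \<in> extensional (finite_index_normal G)"
    and "\<And>N. N \<in> finite_index_normal G \<Longrightarrow> \<exists>g \<in> carrier G. x N = N #> g"
    and "\<And>N M. \<lbrakk>N \<in> finite_index_normal G; M \<in> finite_index_normal G; N \<subseteq> M\<rbrakk>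
          \<Longrightarrow> \<exists>g \<in> carrier G. x N = N #> g \<and> x M = M #> g"
  shows "x \<in> carrier (profinite_completion G)"
proof -
  have "M <#> x N = x M"
    if NM: "N \<in> finite_index_normal G" "M \<in> finite_index_normal G" "N \<subseteq> M" for N M
  proof -
    obtain g where "g \<in> carrier G" "x N = N #> g" "x M = M #> g"
      using assms(3)[OF NM] by blast
    then show ?thesis using NM finite_index_normalD by (simp add: set_mult_rcoset)
  qed
  moreover have "x N \<in> carrier (G Mod N)" if "N \<in> finite_index_normal G" for N
    using assms(2)[OF that] by (auto simp: carrier_FactGroup)
  ultimately show ?thesis
    using assms(1) by (auto simp: profinite_completion_def PiE_def)
qed

lemma completion_eqI:
  assumes "x \<in> carrier (profinite_completion G)" "y \<in> carrier (profinite_completion G)"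
    and "\<And>N. N \<in> finite_index_normal G \<Longrightarrow> x N = y N"
  shows "x = y"
  using assms by (auto simp: profinite_completion_def PiE_def intro: extensionalityI)

lemma mult_completion_apply:
  assumes "x \<in> carrier (profinite_completion G)" "y \<in> carrier (profinite_completion G)"
    and N: "N \<in> finite_index_normal G" and "a \<in> x N" "b \<in> y N"
  shows "(x \<otimes>\<^bsub>profinite_completion G\<^esub> y) N = N #> (a \<otimes> b)"
proof -
  have "(x \<otimes>\<^bsub>profinite_completion G\<^esub> y) N = x N <#> y N"
    using N by (simp add: profinite_completion_def FactGroup_def)
  also have "\<dots> = N #> (a \<otimes> b)"
    using completion_repr[OF assms(1) N assms(4)] completion_repr[OF assms(2) N assms(5)]
      normal.rcos_sum[OF finite_index_normalD(1)[OF N]] by simp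
  finally show ?thesis .
qed

lemma mult_completion_closed:
  assumes x: "x \<in> carrier (profinite_completion G)" and y: "y \<in> carrier (profinite_completion G)"
  shows "x \<otimes>\<^bsub>profinite_completion G\<^esub> y \<in> carrier (profinite_completion G)"
proof (rule completionI)
  show "x \<otimes>\<^bsub>profinite_completion G\<^esub> y \<in> extensional (finite_index_normal G)"
    by (simp add: profinite_completion_def)
  show *: "\<exists>g \<in> carrier G. (x \<otimes>\<^bsub>profinite_completion G\<^esub> y) N = N #> g \<and>
          (x \<otimes>\<^bsub>profinite_completion G\<^esub> y) M = M #> g"
    if NM: "N \<in> finite_index_normal G" "M \<in> finite_index_normal G" "N \<subseteq> M" for N M
  proof -
    obtain a where a: "a \<in> carrier G" "a \<in> x N" using completion_coset[OF x NM(1)] by metis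
    obtain b where b: "b \<in> carrier G" "b \<in> y N" using completion_coset[OF y NM(1)] by metis
    have "a \<in> x M" "b \<in> y M" using completion_mono x y a b NM by metis+
    then show ?thesis using a b NM x y
      by (intro bexI[of _ "a \<otimes> b"] conjI mult_completion_apply) auto
  qed
  show "\<exists>g \<in> carrier G. (x \<otimes>\<^bsub>profinite_completion G\<^esub> y) N = N #> g"
    if "N \<in> finite_index_normal G" for N
    using *[OF that that] by blast
qed

lemma to_completion_apply:
  "N \<in> finite_index_normal G \<Longrightarrow> to_completion G g N = N #> g"
  by (simp add: to_completion_def)

lemma mem_to_completion:
  "N \<in> finite_index_normal G \<Longrightarrow> g \<in> carrier G \<Longrightarrow> g \<in> to_completion G g N"
  by (simp add: to_completion_def rcos_self finite_index_normalD)

end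

section \<open>Extending homomorphisms to the completion\<close>

text \<open>
  The continuous extension to the completion of a homomorphism \<open>f\<close> from \<open>G\<close> to a finite group \<open>K\<close>:
  \<open>f\<close> is constant on the cosets of its kernel, which is one of the subgroups that index the
  completion, so the value is read off from that coordinate.
\<close>

definition completion_ext :: "('a, 'b) monoid_scheme \<Rightarrow> ('c, 'd) monoid_scheme \<Rightarrow> ('a \<Rightarrow> 'c)
    \<Rightarrow> ('a set \<Rightarrow> 'a set) \<Rightarrow> 'c" where
  "completion_ext G K f x = f (SOME g. g \<in> x (kernel G K f))"

context group
begin

text \<open>
  Any coordinate that is fine enough for \<open>f\<close> computes the extension, not only the coordinate at the
  kernel; this is what makes several extensions computable from one representative.
\<close>

lemma completion_ext_eq:
  assumes K: "group K" "finite (carrier K)" and f: "f \<in> hom G K"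
    and x: "x \<in> carrier (profinite_completion G)" and N: "N \<in> finite_index_normal G"
    and le: "N \<subseteq> kernel G K f" and g: "g \<in> x N"
  shows "completion_ext G K f x = f g"
proof -
  let ?N = "kernel G K f"
  have k: "?N \<in> finite_index_normal G" using kernel_finite_index_normal K f by blast
  have g': "g \<in> x ?N" by (rule completion_mono[OF x N g k le])
  define a where "a = (SOME g. g \<in> x ?N)"
  have a: "a \<in> x ?N" unfolding a_def by (rule someI[of "\<lambda>g. g \<in> x ?N", OF g'])
  have "f a = f g"
    by (rule hom_cong_kernel[OF K(1) f finite_index_normalD(2)[OF k] subset_refl])
       (use completion_repr[OF x k a] completion_repr[OF x k g'] in auto)
  then show ?thesis by (simp add: completion_ext_def a_def)
qed

lemma completion_ext_to_completion:
  assumes "group K" "finite (carrier K)" "f \<in> hom G K" "g \<in> carrier G"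
  shows "completion_ext G K f (to_completion G g) = f g"
  using assms
  by (intro completion_ext_eq[OF _ _ _ to_completion_in_carrier[OF is_group]
        kernel_finite_index_normal subset_refl] mem_to_completion kernel_finite_index_normal)

lemma completion_ext_hom:
  assumes K: "group K" "finite (carrier K)" and f: "f \<in> hom G K"
  shows "completion_ext G K f \<in> hom (profinite_completion G) K"
proof (rule homI)
  note k = kernel_finite_index_normal[OF K f]
  fix x assume x: "x \<in> carrier (profinite_completion G)"
  obtain a where a: "a \<in> carrier G" "a \<in> x (kernel G K f)" using completion_coset[OF x k] by metis
  have fx: "completion_ext G K f x = f a"
    by (rule completion_ext_eq[OF K f x k subset_refl a(2)])
  then show "completion_ext G K f x \<in> carrier K" using a f by (auto simp: hom_def)
  fix y assume y: "y \<in> carrier (profinite_completion G)"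
  obtain b where b: "b \<in> carrier G" "b \<in> y (kernel G K f)" using completion_coset[OF y k] by metis
  have fy: "completion_ext G K f y = f b"
    by (rule completion_ext_eq[OF K f y k subset_refl b(2)])
  have "a \<otimes> b \<in> (x \<otimes>\<^bsub>profinite_completion G\<^esub> y) (kernel G K f)"
    using a b mult_completion_apply[OF x y k a(2) b(2)] rcos_self finite_index_normalD(2)[OF k]
    by simp
  then have "completion_ext G K f (x \<otimes>\<^bsub>profinite_completion G\<^esub> y) = f (a \<otimes> b)"
    by (rule completion_ext_eq[OF K f mult_completion_closed[OF x y] k subset_refl])
  then show "completion_ext G K f (x \<otimes>\<^bsub>profinite_completion G\<^esub> y)
      = completion_ext G K f x \<otimes>\<^bsub>K\<^esub> completion_ext G K f y"
    using fx fy a b f by (simp add: hom_mult)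
qed

section \<open>Counting epimorphisms\<close>

lemma hom_eq_on_generate:
  assumes K: "group K" and f: "f \<in> hom G K" "f' \<in> hom G K"
    and S: "S \<subseteq> carrier G" "\<And>s. s \<in> S \<Longrightarrow> f s = f' s" and g: "g \<in> generate G S"
  shows "f g = f' g"
proof -
  interpret f: group_hom G K f by (rule group_homI[OF K f(1)])
  interpret f': group_hom G K f' by (rule group_homI[OF K f(2)])
  show ?thesis
    using g
  proof (induction rule: generate.induct)
    case (eng a b)
    then show ?case using generate_in_carrier[OF S(1)] by simp
  next
    case (inv s)
    then show ?case using S by (metis f.hom_inv f'.hom_inv subsetD)
  qed (use S in auto)
qed

lemma finite_Hom:
  assumes fg: "fg_subgroup G (carrier G)" and K: "group K" "finite (carrier K)"
  shows "finite (Hom G K)"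
proof -
  obtain S where S: "finite S" "S \<subseteq> carrier G" "carrier G = generate G S"
    using fg by (auto simp: fg_subgroup_def)
  have "inj_on (\<lambda>f. restrict f S) (Hom G K)"
  proof (rule inj_onI)
    fix f f' assume f: "f \<in> Hom G K" "f' \<in> Hom G K" and eq: "restrict f S = restrict f' S"
    have "f s = f' s" if "s \<in> S" for s using fun_cong[OF eq, of s] that by simp
    then have "f g = f' g" if "g \<in> carrier G" for g
      using hom_eq_on_generate[OF K(1) _ _ S(2)] f that S(3) by (auto simp: Hom_def)
    then show "f = f'" using f by (auto simp: Hom_def intro: extensionalityI)
  qed
  moreover have "(\<lambda>f. restrict f S) ` Hom G K \<subseteq> S \<rightarrow>\<^sub>E carrier K"
    using S by (auto simp: Hom_def hom_def)
  moreover have "finite (S \<rightarrow>\<^sub>E carrier K)"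
    using S K by (simp add: finite_PiE)
  ultimately show ?thesis by (rule inj_on_finite)
qed

lemma Hom_nonempty: "group K \<Longrightarrow> Hom G K \<noteq> {}"
proof -
  assume "group K"
  then interpret K: group K .
  have "(\<lambda>g\<in>carrier G. \<one>\<^bsub>K\<^esub>) \<in> Hom G K" by (auto simp: Hom_def hom_def)
  then show ?thesis by blast
qed

text \<open>
  The probabilities share the denominator \<open>card (Hom G K)\<close>, which is finite and nonzero because
  \<open>G\<close> is finitely generated; hence the numerators agree.
\<close>

lemma measure_equivalence_card:
  assumes fg: "fg_subgroup G (carrier G)" and me: "measure_equivalence G H L \<alpha>"
    and K: "group K" "finite (carrier K)" and h: "h \<in> Hom (G\<lparr>carrier := L\<rparr>) K"
  shows "card {f \<in> Hom G K. restrict f L = h} = card {f \<in> Hom G K. restrict f H = compose H h \<alpha>}"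
proof -
  have "card (Hom G K) \<noteq> 0" using finite_Hom[OF fg K] Hom_nonempty[OF K(1)] by simp
  then show ?thesis
    using measure_equivalence_finite_group[OF is_group me K h] by (simp add: Pr_def)
qed

lemma card_Hom_by_image:
  assumes fg: "fg_subgroup G (carrier G)"
    and K: "group K" "finite (carrier K)" and K': "subgroup K' K"
  shows "card {f \<in> Hom G (K\<lparr>carrier := K'\<rparr>). P f}
       = (\<Sum>S | subgroup S K \<and> S \<subseteq> K'. card {f \<in> Hom G K. f ` carrier G = S \<and> P f})"
proof -
  have "{f \<in> Hom G (K\<lparr>carrier := K'\<rparr>). P f}
      = (\<Union>S \<in> {S. subgroup S K \<and> S \<subseteq> K'}. {f \<in> Hom G K. f ` carrier G = S \<and> P f})"
    (is "?l = ?r")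
  proof
    show "?l \<subseteq> ?r"
    proof
      fix f assume f: "f \<in> ?l"
      then have fK: "f \<in> hom G K" using subgroup.mem_carrier[OF K'] by (auto simp: Hom_def hom_def)
      have "subgroup (f ` carrier G) K"
        using group_hom.img_is_subgroup[OF group_homI[OF K(1) fK]] .
      moreover have "f ` carrier G \<subseteq> K'" using f by (auto simp: Hom_def hom_def)
      moreover have "f \<in> Hom G K" "P f" using f fK by (auto simp: Hom_def)
      ultimately show "f \<in> ?r" by blast
    qed
    show "?r \<subseteq> ?l"
    proof
      fix f assume "f \<in> ?r"
      then have f: "f \<in> Hom G K" "f ` carrier G \<subseteq> K'" "P f" by blast+
      then have "f \<in> Hom G (K\<lparr>carrier := K'\<rparr>)" by (simp add: Hom_def hom_def image_subset_iff_funcset)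
      then show "f \<in> ?l" using f by simp
    qed
  qed
  moreover have "finite {S. subgroup S K \<and> S \<subseteq> K'}"
    by (rule finite_subset[of _ "Pow (carrier K)"]) (use K in \<open>auto dest: subgroup.subset\<close>)
  moreover have "{f \<in> Hom G K. f ` carrier G = S \<and> P f} \<inter> {f \<in> Hom G K. f ` carrier G = S' \<and> P f} = {}"
    if "S \<noteq> S'" for S S' using that by blast
  ultimately show ?thesis
    using finite_Hom[OF fg K] by (simp only:) (rule card_UN_disjoint, auto)
qed

text \<open>
  The equality of the counts persists when the image of the homomorphism is prescribed. The
  homomorphisms into a subgroup \<open>S\<close> are sorted by their images, so by induction on the size of
  \<open>S\<close> everything cancels except the homomorphisms onto \<open>S\<close> itself. When \<open>h\<close> does not take
  values in \<open>S\<close>, both counts vanish.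
\<close>

lemma measure_equivalence_card_image:
  assumes fg: "fg_subgroup G (carrier G)" and me: "measure_equivalence G H L \<alpha>"
    and K: "group K" "finite (carrier K)" and h: "h \<in> Hom (G\<lparr>carrier := L\<rparr>) K"
    and S: "subgroup S K"
  shows "card {f \<in> Hom G K. f ` carrier G = S \<and> restrict f L = h}
       = card {f \<in> Hom G K. f ` carrier G = S \<and> restrict f H = compose H h \<alpha>}"
  using S
proof (induction "card S" arbitrary: S rule: less_induct)
  case less
  have \<alpha>: "\<alpha> ` H = L"
    using me by (auto simp: measure_equivalence_def iso_def bij_betw_def)
  have sub: "H \<subseteq> carrier G" "L \<subseteq> carrier G"
    using me generate_incl by (auto simp: measure_equivalence_def fg_subgroup_def)
  show ?case
  proof (cases "h ` L \<subseteq> S")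
    case False
    have "h ` L \<subseteq> S" if f: "f ` carrier G = S" "restrict f L = h" for f
      using that sub by auto
    moreover have "h ` L \<subseteq> S" if f: "f ` carrier G = S" "restrict f H = compose H h \<alpha>" for f
    proof -
      have "h (\<alpha> x) \<in> S" if "x \<in> H" for x
      proof -
        have "f x = h (\<alpha> x)" using fun_cong[OF f(2), of x] that by (simp add: compose_def)
        then show ?thesis using f(1) sub that by (metis imageI subsetD)
      qed
      then show ?thesis using \<alpha> by auto
    qed
    ultimately have "{f \<in> Hom G K. f ` carrier G = S \<and> restrict f L = h} = {}"
      and "{f \<in> Hom G K. f ` carrier G = S \<and> restrict f H = compose H h \<alpha>} = {}"
      using False by blast+
    then show ?thesis by (simp only:)
  next
    case True
    let ?T = "{S'. subgroup S' K \<and> S' \<subseteq> S}"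
    let ?l = "\<lambda>S. card {f \<in> Hom G K. f ` carrier G = S \<and> restrict f L = h}"
    let ?r = "\<lambda>S. card {f \<in> Hom G K. f ` carrier G = S \<and> restrict f H = compose H h \<alpha>}"
    have finS: "finite S" using less.prems K by (meson finite_subset subgroup.subset)
    have finT: "finite ?T"
      by (rule finite_subset[of _ "Pow S"]) (use finS in auto)
    have ST: "S \<in> ?T" using less.prems by simp
    have "h \<in> Hom (G\<lparr>carrier := L\<rparr>) (K\<lparr>carrier := S\<rparr>)"
      using h True by (auto simp: Hom_def hom_def)
    then have "sum ?l ?T = sum ?r ?T"
      using measure_equivalence_card[OF fg me group.subgroup_imp_group[OF K(1) less.prems]] finS
      by (simp flip: card_Hom_by_image[OF fg K less.prems])
    moreover have "sum ?l (?T - {S}) = sum ?r (?T - {S})"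
    proof (rule sum.cong[OF refl])
      fix S' assume S': "S' \<in> ?T - {S}"
      then have "card S' < card S" using finS by (intro psubset_card_mono) auto
      then show "?l S' = ?r S'" using less.hyps S' by blast
    qed
    ultimately show ?thesis
      using sum.remove[OF finT ST, of ?l] sum.remove[OF finT ST, of ?r] by linarith
  qed
qed

text \<open>
  The projection onto \<open>G Mod M\<close> is an epimorphism that restricts to the projection on \<open>L\<close>. As the
  counts agree, there is also one that restricts on \<open>H\<close> to \<open>\<alpha>\<close> followed by the projection.
\<close>

lemma measure_equivalence_epi:
  assumes fg: "fg_subgroup G (carrier G)" and me: "measure_equivalence G H L \<alpha>"
    and M: "M \<in> finite_index_normal G"
  shows "\<exists>f \<in> Hom G (G Mod M). f ` carrier G = carrier (G Mod M) \<and> (\<forall>x \<in> H. f x = M #> \<alpha> x)"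
proof -
  note K = finite_Mod[OF M]
  let ?\<pi> = "\<lambda>g. M #> g"
  have L: "L \<subseteq> carrier G" "\<alpha> ` H = L"
    using me generate_incl by (auto simp: measure_equivalence_def fg_subgroup_def iso_def bij_betw_def)
  have \<pi>: "?\<pi> \<in> hom G (G Mod M)"
    using normal.r_coset_hom_Mod[OF finite_index_normalD(1)[OF M]] .
  have "restrict ?\<pi> (carrier G) \<in> Hom G (G Mod M)"
    using \<pi> by (auto simp: Hom_def hom_def)
  then have mem: "restrict ?\<pi> (carrier G) \<in> {f \<in> Hom G (G Mod M). f ` carrier G = carrier (G Mod M)
       \<and> restrict f L = restrict ?\<pi> L}"
    using L by (auto simp: carrier_FactGroup Int_absorb1)
  have h: "restrict ?\<pi> L \<in> Hom (G\<lparr>carrier := L\<rparr>) (G Mod M)"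
  proof -
    have "subgroup L G"
      using me generate_is_subgroup by (auto simp: measure_equivalence_def fg_subgroup_def)
    then show ?thesis
      using \<pi> L by (auto simp: Hom_def hom_def subgroup.m_closed subset_iff)
  qed
  have "card {f \<in> Hom G (G Mod M). f ` carrier G = carrier (G Mod M) \<and> restrict f L = restrict ?\<pi> L} \<noteq> 0"
  proof
    assume "card {f \<in> Hom G (G Mod M). f ` carrier G = carrier (G Mod M) \<and> restrict f L = restrict ?\<pi> L} = 0"
    then have "{f \<in> Hom G (G Mod M). f ` carrier G = carrier (G Mod M) \<and> restrict f L = restrict ?\<pi> L} = {}"
      by (rule card_0_eq[THEN iffD1, rotated]) (use finite_Hom[OF fg K] in simp)
    with mem show False by blast
  qed
  then have "card {f \<in> Hom G (G Mod M). f ` carrier G = carrier (G Mod M)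
      \<and> restrict f H = compose H (restrict ?\<pi> L) \<alpha>} \<noteq> 0"
    using measure_equivalence_card_image[OF fg me K h group.subgroup_self[OF K(1)]] by simp
  then obtain f where f: "f \<in> Hom G (G Mod M)" "f ` carrier G = carrier (G Mod M)"
      "restrict f H = compose H (restrict ?\<pi> L) \<alpha>"
    by (metis (mono_tags, lifting) Collect_empty_eq card.empty)
  have "f x = M #> \<alpha> x" if "x \<in> H" for x
    using fun_cong[OF f(3), of x] that L by (auto simp: compose_def)
  then show ?thesis using f by blast
qed

section \<open>Epimorphisms with a prescribed kernel\<close>

text \<open>
  Epimorphisms onto the same finite quotient can have different kernels. Let \<open>N\<close> be the intersection of
  the kernels of all homomorphisms from \<open>G\<close> to \<open>G Mod M\<close>, which are finite in number. Each such
  homomorphism \<open>u\<close> factors through \<open>G Mod N\<close>, and composing the factor with an epimorphism \<open>f\<close> onto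
  \<open>G Mod N\<close> gives another homomorphism to \<open>G Mod M\<close>, which vanishes on \<open>N\<close>. Thus the factors of
  all \<open>u\<close> vanish on the image of \<open>N\<close> under \<open>f\<close>, so
  \<open>f\<close> vanishes on \<open>N\<close>. It then induces a surjective map from the finite set \<open>G Mod N\<close> to itself,
  which is injective, so the kernel is no larger than \<open>N\<close>.
\<close>

lemma exists_normal_with_unique_epi_kernel:
  assumes fg: "fg_subgroup G (carrier G)" and M: "M \<in> finite_index_normal G"
  shows "\<exists>N \<in> finite_index_normal G. N \<subseteq> M \<and>
    (\<forall>f \<in> hom G (G Mod N). f ` carrier G = carrier (G Mod N) \<longrightarrow> kernel G (G Mod N) f = N)"
proof -
  note K = finite_Mod[OF M]
  define N where "N = \<Inter>(kernel G (G Mod M) ` Hom G (G Mod M)) \<inter> carrier G"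
  have N: "N \<in> finite_index_normal G"
    unfolding N_def
    by (rule Inter_finite_index_normal)
       (use finite_Hom[OF fg K] kernel_finite_index_normal[OF K] in \<open>auto simp: Hom_def\<close>)
  have memN: "w \<in> N" if "w \<in> carrier G" "\<And>u. u \<in> Hom G (G Mod M) \<Longrightarrow> u w = M" for w
    using that by (auto simp: N_def kernel_def)
  have Nle: "N \<subseteq> kernel G (G Mod M) u" if "u \<in> Hom G (G Mod M)" for u
    using that by (auto simp: N_def)
  note Ns = finite_index_normalD[OF N] and Ms = finite_index_normalD[OF M]
  have NM: "N \<subseteq> M"
  proof
    fix g assume g: "g \<in> N"
    have "(\<lambda>g\<in>carrier G. M #> g) \<in> Hom G (G Mod M)"
      using normal.r_coset_hom_Mod[OF Ms(1)] by (auto simp: Hom_def hom_def)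
    then have "(\<lambda>g\<in>carrier G. M #> g) g = M" using g by (auto simp: N_def kernel_def)
    then show "g \<in> M" using g Ms coset_join1 by (auto simp: N_def)
  qed
  have ker: "kernel G (G Mod N) f = N"
    if f: "f \<in> hom G (G Mod N)" and surj: "f ` carrier G = carrier (G Mod N)" for f
  proof -
    have rep: "\<exists>w. w \<in> carrier G \<and> f g = N #> w" if "g \<in> carrier G" for g
    proof -
      have "f g \<in> carrier (G Mod N)" using f that by (simp add: hom_in_carrier)
      then show ?thesis by (auto simp: carrier_FactGroup)
    qed
    have N_ker: "f g = N" if g: "g \<in> N" for g
    proof -
      have gG: "g \<in> carrier G" using g by (simp add: N_def)
      obtain r where r: "\<And>g. g \<in> carrier G \<Longrightarrow> r g \<in> carrier G \<and> f g = N #> r g"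
        using rep by metis
      have "u (r g) = M" if u: "u \<in> Hom G (G Mod M)" for u
      proof -
        have uh: "u \<in> hom G (G Mod M)" using u by (simp add: Hom_def)
        \<comment> \<open>The composition of \<open>f\<close> with the map on \<open>G Mod N\<close> induced by \<open>u\<close>.\<close>
        define v where "v = (\<lambda>g\<in>carrier G. u (r g))"
        have "v \<in> Hom G (G Mod M)"
        proof -
          have "u (r (a \<otimes> b)) = u (r a) \<otimes>\<^bsub>G Mod M\<^esub> u (r b)" if ab: "a \<in> carrier G" "b \<in> carrier G" for a b
          proof -
            have "N #> r (a \<otimes> b) = f a \<otimes>\<^bsub>G Mod N\<^esub> f b"
              using r ab f by (metis hom_mult m_closed)
            also have "\<dots> = N #> (r a \<otimes> r b)"
              using r ab normal.rcos_sum[OF Ns(1)] by (simp add: FactGroup_def)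
            finally have "u (r (a \<otimes> b)) = u (r a \<otimes> r b)"
              using hom_cong_kernel[OF K(1) uh Ns(2) Nle[OF u]] r ab by simp
            then show ?thesis using r ab uh by (simp add: hom_mult)
          qed
          then show ?thesis using r uh by (auto simp: Hom_def hom_def v_def)
        qed
        then have "v g = M" using Nle[of v] g by (auto simp: kernel_def)
        then show ?thesis using gG by (simp add: v_def)
      qed
      then have "r g \<in> N" using r gG by (intro memN) auto
      then show ?thesis using r[OF gG] gG Ns by (simp add: coset_join2)
    qed
    \<comment> \<open>The endomorphism of \<open>G Mod N\<close> induced by \<open>f\<close>.\<close>
    define \<psi> where "\<psi> C = f (SOME g. g \<in> C)" for C
    have \<psi>: "\<psi> (N #> g) = f g" if g: "g \<in> carrier G" for g
    proof -
      define a where "a = (SOME a. a \<in> N #> g)"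
      have a: "a \<in> N #> g" unfolding a_def by (rule someI[of "\<lambda>a. a \<in> N #> g", OF rcos_self[OF g Ns(2)]])
      then have "a \<in> carrier G" using g Ns by (meson r_coset_subset_G subgroup.subset subsetD)
      moreover have "N \<subseteq> kernel G (G Mod N) f"
        using N_ker subgroup.subset[OF Ns(2)] by (auto simp: kernel_def)
      ultimately have "f a = f g"
        by (intro hom_cong_kernel[OF finite_Mod(1)[OF N] f Ns(2)] g
            repr_independence[OF a g Ns(2), symmetric])
      then show ?thesis by (simp add: \<psi>_def a_def)
    qed
    have "\<psi> ` carrier (G Mod N) = carrier (G Mod N)"
      using \<psi> surj by (force simp: carrier_FactGroup image_image)
    then have inj: "inj_on \<psi> (carrier (G Mod N))"
      using finite_Mod(2)[OF N] by (simp add: finite_surj_inj)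
    have "g \<in> N" if g: "g \<in> carrier G" "f g = N" for g
    proof -
      have "\<psi> (N #> g) = \<psi> (N #> \<one>)"
        using \<psi> g N_ker[of \<one>] subgroup.one_closed[OF Ns(2)] by simp
      then have "N #> g = N #> \<one>"
        using inj g by (auto simp: inj_on_def carrier_FactGroup)
      then show "g \<in> N" using g Ns by (metis coset_join1 coset_mult_one subgroup.subset)
    qed
    moreover have "N \<subseteq> carrier G" using Ns by (simp add: subgroup.subset)
    ultimately show ?thesis using N_ker by (simp add: kernel_def set_eq_iff subset_iff) metis
  qed
  show ?thesis
    by (rule bexI[OF _ N]) (intro conjI ballI impI NM ker)
qed

section \<open>Density of the group in its completion\<close>

lemma topspace_profinite_topology: "topspace (profinite_topology G) = carrier (profinite_completion G)"
  by (auto simp: profinite_topology_def profinite_completion_def)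

text \<open>
  A basic open neighbourhood of \<open>z\<close> restricts only finitely many coordinates, and an element of \<open>G\<close>
  that represents \<open>z\<close> at the intersection of their indices agrees with \<open>z\<close> in all of them.
\<close>

lemma dense_to_completion:
  assumes U: "openin (profinite_topology G) U" and z: "z \<in> U"
  shows "\<exists>g \<in> carrier G. to_completion G g \<in> U"
proof -
  let ?I = "finite_index_normal G" and ?D = "\<lambda>N. discrete_topology (carrier (G Mod N))"
  obtain V where V: "openin (product_topology ?D ?I) V"
      "U = V \<inter> carrier (profinite_completion G)"
    using U by (auto simp: profinite_topology_def openin_subtopology)
  have "z \<in> V" using z V(2) by simp
  from V(1)[unfolded openin_product_topology_alt, rule_format, OF this]
  obtain W where W: "finite {i \<in> ?I. W i \<noteq> topspace (?D i)}" "z \<in> Pi\<^sub>E ?I W" "Pi\<^sub>E ?I W \<subseteq> V"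
    by (elim exE conjE) (rule that)
  let ?J = "{i \<in> ?I. W i \<noteq> topspace (?D i)}"
  define Q where "Q = \<Inter>?J \<inter> carrier G"
  have Q: "Q \<in> ?I" unfolding Q_def using W(1) by (intro Inter_finite_index_normal) auto
  have zc: "z \<in> carrier (profinite_completion G)" using z V by auto
  obtain g where g: "g \<in> carrier G" "g \<in> z Q" using completion_coset[OF zc Q] by metis
  have "to_completion G g \<in> Pi\<^sub>E ?I W"
  proof (rule PiE_I)
    fix N assume N: "N \<in> ?I"
    show "to_completion G g N \<in> W N"
    proof (cases "W N = topspace (?D N)")
      case True
      then show ?thesis using N g by (simp add: to_completion_apply carrier_FactGroup)
    next
      case False
      then have "Q \<subseteq> N" using N by (auto simp: Q_def)
      then have "g \<in> z N" using completion_mono[OF zc Q g(2) N] by simp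
      then have "z N = N #> g" using completion_repr[OF zc N] by simp
      then show ?thesis using PiE_mem[OF W(2) N] N by (simp add: to_completion_apply)
    qed
  qed (simp add: to_completion_def)
  then have "to_completion G g \<in> U"
    using V W(3) g to_completion_in_carrier[OF is_group] by auto
  then show ?thesis using g by blast
qed

lemma continuous_component:
  assumes "N \<in> finite_index_normal G"
  shows "continuous_map (profinite_topology G) (discrete_topology (carrier (G Mod N))) (\<lambda>x. x N)"
  unfolding profinite_topology_def
  by (intro continuous_map_from_subtopology continuous_map_product_projection assms)

lemma continuous_surj_approx:
  assumes cont: "continuous_map (profinite_topology G) (profinite_topology G) \<Theta>"
    and surj: "\<Theta> ` carrier (profinite_completion G) = carrier (profinite_completion G)"
    and y: "y \<in> carrier (profinite_completion G)" and N: "N \<in> finite_index_normal G"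
  shows "\<exists>g \<in> carrier G. \<Theta> (to_completion G g) N = y N"
proof -
  have "y \<in> \<Theta> ` carrier (profinite_completion G)" using surj y by simp
  then obtain z where z: "z \<in> carrier (profinite_completion G)" "\<Theta> z = y" by (elim imageE) simp
  have "continuous_map (profinite_topology G) (discrete_topology (carrier (G Mod N))) (\<lambda>x. \<Theta> x N)"
    using continuous_map_compose[OF cont continuous_component[OF N]] by (simp add: o_def)
  moreover have "y N \<in> carrier (G Mod N)"
    using completion_coset[OF y N] by (auto simp: carrier_FactGroup)
  ultimately have "openin (profinite_topology G) {x \<in> topspace (profinite_topology G). \<Theta> x N \<in> {y N}}"
    by (intro openin_continuous_map_preimage) auto
  moreover have "z \<in> {x \<in> topspace (profinite_topology G). \<Theta> x N \<in> {y N}}"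
    using z by (simp add: topspace_profinite_topology)
  ultimately show ?thesis using dense_to_completion by blast
qed

section \<open>Automorphisms of the completion from compatible epimorphisms\<close>

text \<open>
  A compatible family of epimorphisms \<open>f M\<close> onto the finite quotients is a homomorphism from \<open>G\<close>
  to its completion with dense image; it extends to the completion coordinate by coordinate. That
  the extension is bijective is the Hopfian property of finitely generated profinite groups, and
  both halves of it are checked at the cofinal family of subgroups \<open>N\<close> that are the kernel of
  every epimorphism onto \<open>G Mod N\<close>: at such an index, \<open>f N\<close> induces a permutation of
  \<open>G Mod N\<close>.
\<close>

lemma coherent_epis_induce_continuous_auto:
  assumes fg: "fg_subgroup G (carrier G)"
    and f: "\<And>M. M \<in> finite_index_normal G \<Longrightarrow> f M \<in> hom G (G Mod M)"
    and surj: "\<And>M. M \<in> finite_index_normal G \<Longrightarrow> f M ` carrier G = carrier (G Mod M)"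
    and compat: "\<And>N M g. \<lbrakk>N \<in> finite_index_normal G; M \<in> finite_index_normal G; N \<subseteq> M;
        g \<in> carrier G\<rbrakk> \<Longrightarrow> M <#> f N g = f M g"
  shows "\<exists>\<Theta> \<in> continuous_auto G. \<forall>g \<in> carrier G. \<forall>M \<in> finite_index_normal G.
           \<Theta> (to_completion G g) M = f M g"
proof -
  let ?I = "finite_index_normal G" and ?C = "profinite_completion G"
  define T where "T x = (\<lambda>M\<in>?I. completion_ext G (G Mod M) (f M) x)" for x
  define \<Theta> where "\<Theta> = restrict T (carrier ?C)"
  define ker where "ker M = kernel G (G Mod M) (f M)" for M
  have ker: "ker M \<in> ?I" if "M \<in> ?I" for M
    unfolding ker_def by (rule kernel_finite_index_normal[OF finite_Mod[OF that] f[OF that]])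
  have T_eq: "T x M = f M g" if "x \<in> carrier ?C" "M \<in> ?I" "Q \<in> ?I" "Q \<subseteq> ker M" "g \<in> x Q" for x M Q g
    using completion_ext_eq[OF finite_Mod[OF that(2)] f[OF that(2)] that(1,3) _ that(5)] that(2,4)
    by (simp add: T_def ker_def)
  have f_rep: "\<exists>a \<in> carrier G. f M g = M #> a" if "M \<in> ?I" "g \<in> carrier G" for M g
    using hom_in_carrier[OF f[OF that(1)] that(2)] by (auto simp: carrier_FactGroup)
  have f_mono: "f M g = M #> a"
    if "N \<in> ?I" "M \<in> ?I" "N \<subseteq> M" "g \<in> carrier G" "a \<in> carrier G" "f N g = N #> a" for N M g a
    using compat[OF that(1-4)] that set_mult_rcoset finite_index_normalD by simp
  have common: "\<exists>g \<in> carrier G. T x M = f M g \<and> T x N = f N g"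
    if x: "x \<in> carrier ?C" and M: "M \<in> ?I" and N: "N \<in> ?I" for x M N
  proof -
    have Q: "ker M \<inter> ker N \<in> ?I" by (intro Int_finite_index_normal ker M N)
    obtain g where g: "g \<in> carrier G" "g \<in> x (ker M \<inter> ker N)" using completion_coset[OF x Q] by metis
    have "T x M = f M g" "T x N = f N g"
      using T_eq[OF x M Q _ g(2)] T_eq[OF x N Q _ g(2)] by auto
    then show ?thesis using g(1) by metis
  qed
  have closed: "T x \<in> carrier ?C" if x: "x \<in> carrier ?C" for x
  proof (rule completionI)
    show "T x \<in> extensional ?I" by (simp add: T_def)
    show *: "\<exists>a \<in> carrier G. T x N = N #> a \<and> T x M = M #> a"
      if NM: "N \<in> ?I" "M \<in> ?I" "N \<subseteq> M" for N M
    proof -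
      obtain g where g: "g \<in> carrier G" "T x N = f N g" "T x M = f M g"
        using common[OF x NM(1,2)] by metis
      then show ?thesis using f_rep[OF NM(1) g(1)] f_mono[OF NM g(1)] by metis
    qed
    show "\<exists>a \<in> carrier G. T x N = N #> a" if "N \<in> ?I" for N
      using *[OF that that subset_refl] by metis
  qed
  have hom: "T (x \<otimes>\<^bsub>?C\<^esub> y) = T x \<otimes>\<^bsub>?C\<^esub> T y" if x: "x \<in> carrier ?C" and y: "y \<in> carrier ?C" for x y
  proof (rule completion_eqI)
    show "T (x \<otimes>\<^bsub>?C\<^esub> y) \<in> carrier ?C" "T x \<otimes>\<^bsub>?C\<^esub> T y \<in> carrier ?C"
      using closed mult_completion_closed x y by blast+
    fix M assume M: "M \<in> ?I"
    have "completion_ext G (G Mod M) (f M) (x \<otimes>\<^bsub>?C\<^esub> y)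
        = completion_ext G (G Mod M) (f M) x \<otimes>\<^bsub>G Mod M\<^esub> completion_ext G (G Mod M) (f M) y"
      by (rule hom_mult[OF completion_ext_hom[OF finite_Mod[OF M] f[OF M]] x y])
    then show "T (x \<otimes>\<^bsub>?C\<^esub> y) M = (T x \<otimes>\<^bsub>?C\<^esub> T y) M"
      using M by (simp add: T_def profinite_completion_def)
  qed
  have rigid: "\<exists>N \<in> ?I. N \<subseteq> M \<and> ker N = N" if "M \<in> ?I" for M
    using exists_normal_with_unique_epi_kernel[OF fg that] f surj unfolding ker_def by metis
  have inj: "inj_on T (carrier ?C)"
  proof (rule inj_onI)
    fix x y assume x: "x \<in> carrier ?C" and y: "y \<in> carrier ?C" and eq: "T x = T y"
    show "x = y"
    proof (rule completion_eqI[OF x y])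
      fix M assume M: "M \<in> ?I"
      obtain N where N: "N \<in> ?I" "N \<subseteq> M" "ker N = N" using rigid[OF M] by metis
      obtain a where a: "a \<in> carrier G" "a \<in> x N" using completion_coset[OF x N(1)] by metis
      obtain b where b: "b \<in> carrier G" "b \<in> y N" using completion_coset[OF y N(1)] by metis
      have "f N a = f N b"
        using T_eq[OF x N(1) N(1) _ a(2)] T_eq[OF y N(1) N(1) _ b(2)] eq N(3) by simp
      then have "a \<otimes> inv b \<in> ker N"
        unfolding ker_def by (rule hom_eq_imp_kernel[OF finite_Mod(1)[OF N(1)] f[OF N(1)] a(1) b(1)])
      then have "a \<in> N #> b"
        using a b N finite_index_normalD(2)[OF N(1)] by (simp add: subgroup.rcos_module is_group)
      then have "a \<in> y N" using completion_repr[OF y N(1) b(2)] by simp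
      then have am: "a \<in> x M" "a \<in> y M"
        using completion_mono[OF x N(1) a(2) M N(2)] completion_mono[OF y N(1) _ M N(2)] by simp_all
      then show "x M = y M" using completion_repr(2)[OF x M am(1)] completion_repr(2)[OF y M am(2)] by simp
    qed
  qed
  have onto: "T ` carrier ?C = carrier ?C"
  proof
    show "T ` carrier ?C \<subseteq> carrier ?C" using closed by blast
    show "carrier ?C \<subseteq> T ` carrier ?C"
    proof
      fix y assume y: "y \<in> carrier ?C"
      have "\<exists>g \<in> carrier G. f R g = y R" if R: "R \<in> ?I" for R
      proof -
        have "y R \<in> f R ` carrier G"
          using completion_coset[OF y R] surj[OF R] by (metis carrier_FactGroup image_eqI)
        then show ?thesis by (auto simp: image_iff)
      qed
      then obtain w where w: "\<And>R. R \<in> ?I \<Longrightarrow> w R \<in> carrier G \<and> f R (w R) = y R" by metis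
      obtain n where n: "\<And>M. M \<in> ?I \<Longrightarrow> n M \<in> ?I \<and> n M \<subseteq> M \<and> ker (n M) = n M"
        using rigid by metis
      \<comment> \<open>The preimage \<open>x\<close> of \<open>y\<close>. At the index \<open>M\<close> an \<open>f (n M)\<close>-preimage of \<open>y (n M)\<close> is used, since
        it is unique modulo \<open>n M\<close> and hence modulo \<open>M\<close>; an \<open>f M\<close>-preimage of \<open>y M\<close> need not be
        unique modulo \<open>M\<close>.\<close>
      define z where "z M = w (n M)" for M
      have z: "z M \<in> carrier G" if "M \<in> ?I" for M using w n that by (simp add: z_def)
      define x where "x = (\<lambda>M\<in>?I. M #> z M)"
      have w_x: "M #> w R = x M" if M: "M \<in> ?I" and R: "R \<in> ?I" and le: "R \<subseteq> n M" for M R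
      proof -
        have nM: "n M \<in> ?I" "n M \<subseteq> M" "ker (n M) = n M" using n M by auto
        have wR: "w R \<in> carrier G" "f R (w R) = y R" using w R by auto
        have "f (n M) (w R) = n M <#> f R (w R)" using compat[OF R nM(1) le wR(1)] by simp
        also have "\<dots> = y (n M)" using y R nM le wR by (auto simp: profinite_completion_def)
        also have "\<dots> = f (n M) (z M)" using w nM(1) by (simp add: z_def)
        finally have eq: "f (n M) (w R) = f (n M) (z M)" .
        have "w R \<otimes> inv (z M) \<in> ker (n M)"
          unfolding ker_def
          by (rule hom_eq_imp_kernel[OF finite_Mod(1)[OF nM(1)] f[OF nM(1)] wR(1) z[OF M] eq])
        then have "w R \<otimes> inv (z M) \<in> M" using nM by auto
        then have "w R \<in> M #> z M"
          using wR z[OF M] finite_index_normalD(2)[OF M] by (simp add: subgroup.rcos_module is_group)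
        then show ?thesis
          using rcoset_eq_iff[OF finite_index_normalD(2)[OF M] wR(1) z[OF M]] M by (simp add: x_def)
      qed
      have x: "x \<in> carrier ?C"
      proof (rule completionI)
        show "x \<in> extensional ?I" by (simp add: x_def)
        show "\<exists>g \<in> carrier G. x N = N #> g" if "N \<in> ?I" for N
          using z that by (auto simp: x_def)
        show "\<exists>g \<in> carrier G. x N = N #> g \<and> x M = M #> g" if "N \<in> ?I" "M \<in> ?I" "N \<subseteq> M" for N M
        proof (intro bexI conjI)
          have R: "n N \<inter> n M \<in> ?I" using n that by (intro Int_finite_index_normal) auto
          show "w (n N \<inter> n M) \<in> carrier G" using w[OF R] by simp
          show "x N = N #> w (n N \<inter> n M)" "x M = M #> w (n N \<inter> n M)"
            using w_x[OF that(1) R] w_x[OF that(2) R] by simp_all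
        qed
      qed
      have "T x = y"
      proof (rule completion_eqI[OF closed[OF x] y])
        fix M assume M: "M \<in> ?I"
        define R where "R = n (ker M) \<inter> M"
        have nk: "n (ker M) \<in> ?I" using n ker M by simp
        have R: "R \<in> ?I" unfolding R_def by (rule Int_finite_index_normal[OF nk M])
        have RM: "R \<subseteq> M" by (simp add: R_def)
        have "w R \<in> ker M #> w R"
          using w[OF R] finite_index_normalD(2)[OF ker[OF M]] by (simp add: rcos_self)
        then have "w R \<in> x (ker M)" using w_x[OF ker[OF M] R] by (simp add: R_def)
        then have "T x M = f M (w R)" by (rule T_eq[OF x M ker[OF M] subset_refl])
        also have "\<dots> = M <#> f R (w R)" using compat[OF R M RM, of "w R"] w[OF R] by simp
        also have "\<dots> = M <#> y R" using w[OF R] by simp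
        also have "\<dots> = y M" using y R M RM by (auto simp: profinite_completion_def)
        finally show "T x M = y M" .
      qed
      then show "y \<in> T ` carrier ?C" using x by blast
    qed
  qed
  have "\<Theta> \<in> auto ?C"
  proof -
    have "bij_betw \<Theta> (carrier ?C) (carrier ?C)"
      using inj onto by (simp add: bij_betw_def \<Theta>_def inj_on_restrict_eq)
    then have "\<Theta> \<in> Bij (carrier ?C)" by (simp add: Bij_def \<Theta>_def)
    moreover have "\<Theta> \<in> hom ?C ?C"
      by (rule homI) (simp_all add: \<Theta>_def closed hom mult_completion_closed)
    ultimately show ?thesis by (simp add: auto_def)
  qed
  moreover have "continuous_map (profinite_topology G) (profinite_topology G) \<Theta>"
  proof -
    \<comment> \<open>The coordinate of \<open>\<Theta> x\<close> at \<open>M\<close> depends only on that of \<open>x\<close> at \<open>ker M\<close>.\<close>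
    have comp: "continuous_map (profinite_topology G) (discrete_topology (carrier (G Mod M))) (\<lambda>x. \<Theta> x M)"
      if M: "M \<in> ?I" for M
    proof -
      define \<psi> where "\<psi> C = f M (SOME g. g \<in> C)" for C
      have "\<psi> C \<in> carrier (G Mod M)" if C: "C \<in> carrier (G Mod ker M)" for C
      proof -
        obtain g where g: "g \<in> carrier G" "C = ker M #> g" using C by (auto simp: carrier_FactGroup)
        note s = finite_index_normalD(2)[OF ker[OF M]]
        define a where "a = (SOME a. a \<in> C)"
        have "a \<in> C" unfolding a_def using rcos_self[OF g(1) s] g(2) by (metis someI)
        then have "a \<in> carrier G"
          using g by (meson r_coset_subset_G subgroup.subset[OF s] subsetD)
        then show ?thesis using f[OF M] by (simp add: \<psi>_def hom_in_carrier flip: a_def)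
      qed
      then have "continuous_map (discrete_topology (carrier (G Mod ker M)))
          (discrete_topology (carrier (G Mod M))) \<psi>"
        by (simp add: Pi_iff)
      from continuous_map_compose[OF continuous_component[OF ker[OF M]] this]
      have "continuous_map (profinite_topology G) (discrete_topology (carrier (G Mod M))) (\<lambda>x. \<psi> (x (ker M)))"
        by (simp only: o_def)
      then show ?thesis
        by (rule continuous_map_eq)
           (simp add: \<Theta>_def T_def \<psi>_def ker_def completion_ext_def M topspace_profinite_topology)
    qed
    have "continuous_map (profinite_topology G)
        (product_topology (\<lambda>N. discrete_topology (carrier (G Mod N))) ?I) \<Theta>"
      unfolding continuous_map_componentwise
      using comp closed
      by (auto simp: topspace_profinite_topology \<Theta>_def T_def)
    moreover have "\<Theta> \<in> topspace (profinite_topology G) \<rightarrow> carrier ?C"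
      using closed by (simp add: topspace_profinite_topology \<Theta>_def)
    ultimately show ?thesis
      by (subst (2) profinite_topology_def) (simp add: continuous_map_in_subtopology image_subset_iff_funcset)
  qed
  ultimately have "\<Theta> \<in> continuous_auto G" by (simp add: continuous_auto_def)
  moreover have "\<Theta> (to_completion G g) M = f M g" if g: "g \<in> carrier G" and M: "M \<in> ?I" for g M
    using completion_ext_to_completion[OF finite_Mod[OF M] f[OF M] g] M
      to_completion_in_carrier[OF is_group g] by (simp add: \<Theta>_def T_def)
  ultimately show ?thesis by blast
qed

end

section \<open>Inverse limits of finite sets\<close>

text \<open>
  A compactness argument: in the product of the finite discrete spaces \<open>P i\<close>, each compatibility
  condition cuts out a closed set, and finitely many conditions are satisfied at once by pushing
  forward one element from an index \<open>q\<close> beyond all indices involved.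
\<close>

lemma finite_inverse_limit_nonempty:
  fixes P :: "'i \<Rightarrow> 'x set" and t :: "'i \<Rightarrow> 'i \<Rightarrow> 'x \<Rightarrow> 'x"
  assumes fin: "\<And>i. i \<in> I \<Longrightarrow> finite (P i)" and ne: "\<And>i. i \<in> I \<Longrightarrow> P i \<noteq> {}"
    and directed: "\<And>F. finite F \<Longrightarrow> F \<subseteq> I \<Longrightarrow> \<exists>q \<in> I. \<forall>i \<in> F. R q i"
    and trans: "\<And>i j k. R i j \<Longrightarrow> R j k \<Longrightarrow> R i k"
    and maps: "\<And>i j x. \<lbrakk>i \<in> I; j \<in> I; R i j; x \<in> P i\<rbrakk> \<Longrightarrow> t i j x \<in> P j"
    and comp: "\<And>i j k x. \<lbrakk>i \<in> I; j \<in> I; k \<in> I; R i j; R j k; x \<in> P i\<rbrakk> \<Longrightarrow> t j k (t i j x) = t i k x"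
  shows "\<exists>x \<in> Pi\<^sub>E I P. \<forall>i \<in> I. \<forall>j \<in> I. R i j \<longrightarrow> t i j (x i) = x j"
proof -
  define X where "X = product_topology (\<lambda>i. discrete_topology (P i)) I"
  have top: "topspace X = Pi\<^sub>E I P" by (simp add: X_def)
  define A where "A = {(i, j). i \<in> I \<and> j \<in> I \<and> R i j}"
  define C where "C = (\<lambda>(i, j). {x \<in> topspace X. t i j (x i) = x j})"
  have compact: "compact_space X"
    unfolding X_def using fin by (simp add: compact_space_product_topology compact_space_discrete_topology)
  have closed: "closedin X D" if "D \<in> insert (topspace X) (C ` A)" for D
  proof -
    have "closedin X {x \<in> topspace X. t i j (x i) = x j}" if ij: "i \<in> I" "j \<in> I" "R i j" for i j
    proof (rule closedin_continuous_maps_eq[where Y = "discrete_topology (P j)"])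
      have i: "continuous_map X (discrete_topology (P i)) (\<lambda>x. x i)"
        unfolding X_def using ij by (intro continuous_map_product_projection)
      have "continuous_map (discrete_topology (P i)) (discrete_topology (P j)) (t i j)"
        using maps ij by auto
      from continuous_map_compose[OF i this]
      show "continuous_map X (discrete_topology (P j)) (\<lambda>x. t i j (x i))"
        by (simp only: o_def)
      show "continuous_map X (discrete_topology (P j)) (\<lambda>x. x j)"
        unfolding X_def using ij by (intro continuous_map_product_projection)
    qed (rule Hausdorff_space_discrete_topology)
    then show ?thesis using that by (auto simp: A_def C_def)
  qed
  have fip: "\<Inter>F \<noteq> {}" if F: "finite F" "F \<subseteq> insert (topspace X) (C ` A)" for F
  proof -
    obtain B where B: "B \<subseteq> A" "finite B" "F - {topspace X} = C ` B"
    proof -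
      have "finite (F - {topspace X})" "F - {topspace X} \<subseteq> C ` A" using F by auto
      from finite_subset_image[OF this] show ?thesis using that by blast
    qed
    have "finite (fst ` B \<union> snd ` B)" "fst ` B \<union> snd ` B \<subseteq> I"
      using B by (auto simp: A_def)
    from directed[OF this] obtain q where q: "q \<in> I" "\<And>i. i \<in> fst ` B \<union> snd ` B \<Longrightarrow> R q i"
      by (elim bexE) (simp only: Ball_def)
    obtain p where p: "p \<in> P q" using ne[OF q(1)] by blast
    \<comment> \<open>Coordinates that \<open>q\<close> does not reach occur in none of the conditions and are filled arbitrarily.\<close>
    define x where "x = (\<lambda>i\<in>I. if R q i then t q i p else (SOME y. y \<in> P i))"
    have "x \<in> Pi\<^sub>E I P"
      using maps[OF q(1) _ _ p] ne by (auto simp: x_def some_in_eq)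
    moreover have "x \<in> C b" if "b \<in> B" for b
    proof -
      obtain i j where b: "b = (i, j)" by force
      have "i \<in> I" "j \<in> I" "R i j" using that B b by (auto simp: A_def)
      moreover have "R q i" "R q j" using q(2) that b by force+
      ultimately show ?thesis
        using comp[OF q(1), of i j p] p \<open>x \<in> Pi\<^sub>E I P\<close> by (simp add: b C_def top x_def)
    qed
    ultimately have xB: "x \<in> topspace X" "\<And>b. b \<in> B \<Longrightarrow> x \<in> C b" by (simp_all add: top)
    have "x \<in> D" if "D \<in> F" for D
    proof (cases "D = topspace X")
      case False
      then have "D \<in> C ` B" using that B(3) by blast
      then show ?thesis using xB(2) by blast
    qed (simp add: xB(1))
    then have "x \<in> \<Inter>F" by blast
    then show ?thesis by blast
  qed
  have "\<Inter>(insert (topspace X) (C ` A)) \<noteq> {}"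
    by (rule compact_space_fip[THEN iffD1, OF compact, THEN spec, THEN mp])
       (intro conjI ballI allI impI closed, assumption, elim conjE, rule fip)
  then obtain x where "x \<in> \<Inter>(insert (topspace X) (C ` A))" by blast
  then have "x \<in> Pi\<^sub>E I P" "\<And>i j. i \<in> I \<Longrightarrow> j \<in> I \<Longrightarrow> R i j \<Longrightarrow> t i j (x i) = x j"
    by (auto simp: top A_def C_def)
  then show ?thesis by blast
qed

section \<open>Measure equivalences as restrictions of automorphisms\<close>

context group
begin

text \<open>
  The epimorphisms \<open>f\<close> onto \<open>G Mod M\<close> with \<open>f x = M #> \<alpha> x\<close> on \<open>H\<close> form, for varying \<open>M\<close>, an inverse
  system of finite sets, and these are nonempty by counting. A point of the limit
  is a compatible family of epimorphisms, which induces the automorphism.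
\<close>

lemma measure_equivalence_extends:
  assumes fg: "fg_subgroup G (carrier G)" and me: "measure_equivalence G H L \<alpha>"
  shows "\<exists>\<Theta> \<in> continuous_auto G. \<forall>x \<in> H. \<Theta> (to_completion G x) = to_completion G (\<alpha> x)"
proof -
  let ?I = "finite_index_normal G"
  have L: "H \<subseteq> carrier G" "L \<subseteq> carrier G" "\<And>x. x \<in> H \<Longrightarrow> \<alpha> x \<in> L"
    using me generate_incl by (auto simp: measure_equivalence_def fg_subgroup_def iso_def hom_def)
  then have \<alpha>: "\<And>x. x \<in> H \<Longrightarrow> x \<in> carrier G \<and> \<alpha> x \<in> carrier G" by auto
  define P where "P M = {f \<in> Hom G (G Mod M). f ` carrier G = carrier (G Mod M) \<and>
      (\<forall>x \<in> H. f x = M #> \<alpha> x)}" for M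
  define t where "t = (\<lambda>(N::'a set) M f. \<lambda>g\<in>carrier G. M <#> f g)"
  have rep: "\<exists>a \<in> carrier G. f g = N #> a" if "f \<in> Hom G (G Mod N)" "g \<in> carrier G" for f g N
  proof -
    have "f g \<in> carrier (G Mod N)" using that hom_in_carrier[of f G "G Mod N" g] by (simp add: Hom_def)
    then show ?thesis by (auto simp: carrier_FactGroup)
  qed
  have smr: "M <#> (N #> g) = M #> g" if "N \<in> ?I" "M \<in> ?I" "N \<subseteq> M" "g \<in> carrier G" for N M g
    using that finite_index_normalD set_mult_rcoset by simp
  have "\<exists>f \<in> Pi\<^sub>E ?I P. \<forall>N \<in> ?I. \<forall>M \<in> ?I. N \<subseteq> M \<longrightarrow> t N M (f N) = f M"
  proof (rule finite_inverse_limit_nonempty)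
    fix M assume M: "M \<in> ?I"
    show "finite (P M)" using finite_Hom[OF fg finite_Mod[OF M]] by (simp add: P_def)
    show "P M \<noteq> {}" using measure_equivalence_epi[OF fg me M] by (auto simp: P_def)
  next
    fix F assume "finite F" "F \<subseteq> ?I"
    from Inter_finite_index_normal[OF this] show "\<exists>q \<in> ?I. \<forall>i \<in> F. q \<subseteq> i"
      by (rule bexI[rotated]) auto
  next
    fix N M f assume NM: "N \<in> ?I" "M \<in> ?I" "N \<subseteq> M" and f: "f \<in> P N"
    have fH: "f \<in> Hom G (G Mod N)" "f ` carrier G = carrier (G Mod N)" "\<And>x. x \<in> H \<Longrightarrow> f x = N #> \<alpha> x"
      using f by (auto simp: P_def)
    obtain r where r: "\<And>g. g \<in> carrier G \<Longrightarrow> r g \<in> carrier G \<and> f g = N #> r g"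
      using rep[OF fH(1)] by metis
    have tr: "t N M f g = M #> r g" if "g \<in> carrier G" for g
      using r smr[OF NM] that by (simp add: t_def)
    have "t N M f (a \<otimes> b) = t N M f a \<otimes>\<^bsub>G Mod M\<^esub> t N M f b" if ab: "a \<in> carrier G" "b \<in> carrier G" for a b
    proof -
      have "f (a \<otimes> b) = f a \<otimes>\<^bsub>G Mod N\<^esub> f b" using fH(1) hom_mult[of f G "G Mod N" a b] ab by (simp only: Hom_def Int_iff)
      also have "\<dots> = N #> (r a \<otimes> r b)"
        using r ab normal.rcos_sum[OF finite_index_normalD(1)[OF NM(1)]] by (simp add: FactGroup_def)
      finally have "t N M f (a \<otimes> b) = M #> (r a \<otimes> r b)"
        using ab r smr[OF NM] by (simp add: t_def)
      also have "\<dots> = (M #> r a) <#> (M #> r b)"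
        using r ab normal.rcos_sum[OF finite_index_normalD(1)[OF NM(2)]] by simp
      finally show ?thesis using tr ab by (simp add: FactGroup_def)
    qed
    moreover have "t N M f g \<in> carrier (G Mod M)" if "g \<in> carrier G" for g
      using tr r that by (simp add: carrier_FactGroup)
    ultimately have "t N M f \<in> Hom G (G Mod M)"
      by (simp add: Hom_def hom_def t_def)
    moreover have "t N M f ` carrier G = carrier (G Mod M)"
    proof
      show "t N M f ` carrier G \<subseteq> carrier (G Mod M)"
        using tr r by (auto simp: carrier_FactGroup)
      show "carrier (G Mod M) \<subseteq> t N M f ` carrier G"
      proof
        fix C assume "C \<in> carrier (G Mod M)"
        then obtain b where b: "b \<in> carrier G" "C = M #> b" by (auto simp: carrier_FactGroup)
        have "N #> b \<in> f ` carrier G" using fH(2) b by (simp add: carrier_FactGroup)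
        then obtain g where g: "g \<in> carrier G" "f g = N #> b" by auto
        then have "t N M f g = C" using smr[OF NM] b by (simp add: t_def)
        then show "C \<in> t N M f ` carrier G" using g by blast
      qed
    qed
    moreover have "t N M f x = M #> \<alpha> x" if "x \<in> H" for x
      using fH(3) \<alpha> smr[OF NM] that by (simp add: t_def)
    ultimately show "t N M f \<in> P M" by (simp add: P_def)
  next
    fix Q N M f assume I: "Q \<in> ?I" "N \<in> ?I" "M \<in> ?I" "Q \<subseteq> N" "N \<subseteq> M" and f: "f \<in> P Q"
    show "t N M (t Q N f) = t Q M f"
    proof -
      have "M <#> (N <#> f g) = M <#> f g" if "g \<in> carrier G" for g
      proof -
        have "f \<in> Hom G (G Mod Q)" using f by (simp add: P_def)
        from rep[OF this that] obtain a where a: "a \<in> carrier G" "f g = Q #> a" by (elim bexE)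
        have "Q \<subseteq> M" using I(4,5) by (rule subset_trans)
        then show ?thesis
          using a smr[OF I(1,2,4)] smr[OF I(2,3,5)] smr[OF I(1,3)] by simp
      qed
      then show ?thesis by (simp add: t_def restrict_def fun_eq_iff)
    qed
  qed auto
  then obtain f where f: "f \<in> Pi\<^sub>E ?I P"
    and coh: "\<And>N M. N \<in> ?I \<Longrightarrow> M \<in> ?I \<Longrightarrow> N \<subseteq> M \<Longrightarrow> t N M (f N) = f M"
    by metis
  have fP: "f M \<in> P M" if "M \<in> ?I" for M using PiE_mem[OF f that] .
  have "\<exists>\<Theta> \<in> continuous_auto G. \<forall>g \<in> carrier G. \<forall>M \<in> ?I. \<Theta> (to_completion G g) M = f M g"
  proof (rule coherent_epis_induce_continuous_auto[OF fg])
    fix M assume "M \<in> ?I"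
    from fP[OF this] show "f M \<in> hom G (G Mod M)" "f M ` carrier G = carrier (G Mod M)"
      by (simp_all add: P_def Hom_def)
  next
    fix N M g assume NM: "N \<in> ?I" "M \<in> ?I" "N \<subseteq> M" "g \<in> carrier G"
    show "M <#> f N g = f M g"
      using fun_cong[OF coh[OF NM(1-3)], of g] NM(4) by (simp add: t_def)
  qed
  then obtain \<Theta> where \<Theta>: "\<Theta> \<in> continuous_auto G"
    and eq: "\<And>g M. g \<in> carrier G \<Longrightarrow> M \<in> ?I \<Longrightarrow> \<Theta> (to_completion G g) M = f M g" by metis
  have "\<Theta> (to_completion G x) = to_completion G (\<alpha> x)" if x: "x \<in> H" for x
  proof (rule completion_eqI)
    have "\<Theta> \<in> hom (profinite_completion G) (profinite_completion G)"
      using \<Theta> by (simp add: continuous_auto_def auto_def)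
    then show "\<Theta> (to_completion G x) \<in> carrier (profinite_completion G)"
      using to_completion_in_carrier[OF is_group] \<alpha>[OF x] by (simp add: hom_in_carrier)
    show "to_completion G (\<alpha> x) \<in> carrier (profinite_completion G)"
      using to_completion_in_carrier[OF is_group] \<alpha>[OF x] by simp
    fix M assume M: "M \<in> ?I"
    show "\<Theta> (to_completion G x) M = to_completion G (\<alpha> x) M"
      using eq[OF _ M] fP[OF M] x \<alpha>[OF x] M by (simp add: P_def to_completion_apply)
  qed
  then show ?thesis using \<Theta> by blast
qed

text \<open>
  Extending a homomorphism \<open>f\<close> from \<open>G\<close> to \<open>K\<close> to the completion, composing with \<open>\<Theta>\<close> and
  restricting to \<open>G\<close> defines a self-map \<open>T\<close> of \<open>Hom G K\<close>. Since \<open>\<Theta>\<close> maps \<open>G\<close> onto a dense subset,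
  \<open>T\<close> is injective, hence a permutation of this finite set. On \<open>H\<close>, \<open>T f\<close> equals
  \<open>f\<close> composed with \<open>\<alpha>\<close>, so \<open>T\<close> matches the homomorphisms that are counted on the two sides.
\<close>

lemma continuous_auto_restricts_to_measure_equivalence:
  assumes fg: "fg_subgroup G (carrier G)" and lerf: "LERF G" and H: "fg_subgroup G H"
    and \<Theta>: "\<Theta> \<in> continuous_auto G"
    and \<alpha>: "\<And>x. x \<in> H \<Longrightarrow> \<alpha> x \<in> carrier G \<and> to_completion G (\<alpha> x) = \<Theta> (to_completion G x)"
  shows "measure_equivalence G H (\<alpha> ` H) \<alpha>"
proof -
  let ?C = "profinite_completion G"
  have \<Theta>h: "\<Theta> \<in> hom ?C ?C" and \<Theta>b: "bij_betw \<Theta> (carrier ?C) (carrier ?C)"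
    and cont: "continuous_map (profinite_topology G) (profinite_topology G) \<Theta>"
    using \<Theta> by (auto simp: continuous_auto_def auto_def Bij_def)
  have inj: "inj_on (to_completion G) (carrier G)"
    by (rule inj_on_to_completion[OF is_group lerf])
  have \<iota>: "to_completion G g \<in> carrier ?C" if "g \<in> carrier G" for g
    using to_completion_in_carrier[OF is_group that] .
  have \<iota>m: "to_completion G (a \<otimes> b) = to_completion G a \<otimes>\<^bsub>?C\<^esub> to_completion G b"
    if "a \<in> carrier G" "b \<in> carrier G" for a b
    using hom_mult[OF to_completion_hom[OF is_group] that] .
  obtain S where S: "finite S" "S \<subseteq> carrier G" "H = generate G S"
    using H by (auto simp: fg_subgroup_def)
  have sub: "subgroup H G" using S generate_is_subgroup by simp
  have HG: "H \<subseteq> carrier G" using subgroup.subset[OF sub] .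
  have \<alpha>G: "\<alpha> x \<in> carrier G" "to_completion G (\<alpha> x) = \<Theta> (to_completion G x)" if "x \<in> H" for x
    using \<alpha>[OF that] by auto
  have mult: "\<alpha> (x \<otimes> y) = \<alpha> x \<otimes> \<alpha> y" if x: "x \<in> H" and y: "y \<in> H" for x y
  proof -
    have xy: "x \<otimes> y \<in> H" "x \<in> carrier G" "y \<in> carrier G"
      using subgroup.m_closed[OF sub x y] HG x y by auto
    have "to_completion G (\<alpha> (x \<otimes> y)) = \<Theta> (to_completion G x \<otimes>\<^bsub>?C\<^esub> to_completion G y)"
      using \<alpha>G(2)[OF xy(1)] \<iota>m xy by simp
    also have "\<dots> = to_completion G (\<alpha> x) \<otimes>\<^bsub>?C\<^esub> to_completion G (\<alpha> y)"
      using hom_mult[OF \<Theta>h \<iota>[OF xy(2)] \<iota>[OF xy(3)]] \<alpha>G x y by simp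
    also have "\<dots> = to_completion G (\<alpha> x \<otimes> \<alpha> y)" using \<iota>m \<alpha>G x y by simp
    finally show ?thesis using inj_onD[OF inj] \<alpha>G xy(1) x y by simp
  qed
  have inj_\<alpha>: "inj_on \<alpha> H"
  proof (rule inj_onI)
    fix x y assume x: "x \<in> H" and y: "y \<in> H" and "\<alpha> x = \<alpha> y"
    then have "\<Theta> (to_completion G x) = \<Theta> (to_completion G y)" using \<alpha>G(2) by metis
    moreover have "x \<in> carrier G" "y \<in> carrier G" using x y HG by auto
    ultimately show "x = y"
      using inj_onD[OF bij_betw_imp_inj_on[OF \<Theta>b]] inj_onD[OF inj] \<iota> by metis
  qed
  have \<alpha>_iso: "\<alpha> \<in> iso (G\<lparr>carrier := H\<rparr>) (G\<lparr>carrier := \<alpha> ` H\<rparr>)"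
    using mult inj_\<alpha> by (auto simp: iso_def hom_def bij_betw_def)
  have "fg_subgroup G (\<alpha> ` H)"
  proof -
    have "\<alpha> \<in> hom (G\<lparr>carrier := H\<rparr>) G" using mult \<alpha>G by (auto simp: hom_def)
    then interpret \<alpha>: group_hom "G\<lparr>carrier := H\<rparr>" G \<alpha>
      using subgroup_imp_group[OF sub] is_group by (simp add: group_hom_def group_hom_axioms_def)
    have SH: "S \<subseteq> H" using S(3) generate.incl by (metis subsetI)
    have "generate G (\<alpha> ` S) = \<alpha> ` generate (G\<lparr>carrier := H\<rparr>) S"
      using \<alpha>.generate_img SH by simp
    also have "generate (G\<lparr>carrier := H\<rparr>) S = H"
      using generate_consistent[OF SH sub] S(3) by simp
    finally show ?thesis
      unfolding fg_subgroup_def using S(1) SH \<alpha>G(1) by (intro exI[of _ "\<alpha> ` S"]) auto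
  qed
  moreover have "Pr G (\<alpha> ` H) K h = Pr G H K (compose H h \<alpha>)"
    if K: "group K" "finite (carrier K)" and h: "h \<in> Hom (G\<lparr>carrier := \<alpha> ` H\<rparr>) K" for K :: "nat monoid" and h
  proof -
    define T where "T f = (\<lambda>g\<in>carrier G. completion_ext G K f (\<Theta> (to_completion G g)))" for f
    have T_Hom: "T f \<in> Hom G K" if "f \<in> Hom G K" for f
    proof -
      have "completion_ext G K f \<in> hom ?C K"
        using completion_ext_hom[OF K] that by (simp add: Hom_def)
      then have "completion_ext G K f \<circ> (\<Theta> \<circ> to_completion G) \<in> hom G K"
        by (intro Group.hom_compose[OF Group.hom_compose[OF to_completion_hom[OF is_group] \<Theta>h]])
      then show ?thesis by (simp add: Hom_def T_def hom_def Pi_iff)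
    qed
    have inj_T: "inj_on T (Hom G K)"
    proof (rule inj_onI)
      fix f f' assume f: "f \<in> Hom G K" and f': "f' \<in> Hom G K" and eq: "T f = T f'"
      have fh: "f \<in> hom G K" "f' \<in> hom G K" using f f' by (auto simp: Hom_def)
      define N where "N = kernel G K f \<inter> kernel G K f'"
      have N: "N \<in> finite_index_normal G"
        unfolding N_def using kernel_finite_index_normal[OF K] fh by (intro Int_finite_index_normal) auto
      have "f g = f' g" if g: "g \<in> carrier G" for g
      proof -
        obtain a where a: "a \<in> carrier G" "\<Theta> (to_completion G a) N = to_completion G g N"
          using continuous_surj_approx[OF cont bij_betw_imp_surj_on[OF \<Theta>b] \<iota>[OF g] N] by metis
        have y: "\<Theta> (to_completion G a) \<in> carrier ?C" using hom_in_carrier[OF \<Theta>h \<iota>[OF a(1)]] .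
        have gN: "g \<in> \<Theta> (to_completion G a) N" using mem_to_completion[OF N g] a by simp
        have "f g = T f a"
          using completion_ext_eq[OF K fh(1) y N _ gN] a by (simp add: T_def N_def)
        moreover have "f' g = T f' a"
          using completion_ext_eq[OF K fh(2) y N _ gN] a by (simp add: T_def N_def)
        ultimately show ?thesis using eq by simp
      qed
      then show "f = f'" using f f' by (auto simp: Hom_def intro: extensionalityI)
    qed
    have surj_T: "T ` Hom G K = Hom G K"
      using T_Hom by (intro endo_inj_surj[OF finite_Hom[OF fg K] _ inj_T]) blast
    have iff: "restrict f (\<alpha> ` H) = h \<longleftrightarrow> restrict (T f) H = compose H h \<alpha>" if f: "f \<in> Hom G K" for f
    proof -
      have Tx: "T f x = f (\<alpha> x)" if x: "x \<in> H" for x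
      proof -
        have "T f x = completion_ext G K f (to_completion G (\<alpha> x))"
          using x HG \<alpha>G(2)[OF x] by (auto simp: T_def)
        also have "\<dots> = f (\<alpha> x)"
          using completion_ext_to_completion[OF K _ \<alpha>G(1)[OF x]] f by (simp add: Hom_def)
        finally show ?thesis .
      qed
      have "restrict f (\<alpha> ` H) = h \<longleftrightarrow> (\<forall>x \<in> H. f (\<alpha> x) = h (\<alpha> x))"
        using h by (auto simp: Hom_def fun_eq_iff restrict_def extensional_def)
      also have "\<dots> \<longleftrightarrow> restrict (T f) H = compose H h \<alpha>"
        using Tx by (auto simp: fun_eq_iff restrict_def compose_def)
      finally show ?thesis .
    qed
    have image: "T ` {f \<in> Hom G K. restrict f (\<alpha> ` H) = h} = {f \<in> Hom G K. restrict f H = compose H h \<alpha>}"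
    proof
      show "T ` {f \<in> Hom G K. restrict f (\<alpha> ` H) = h} \<subseteq> {f \<in> Hom G K. restrict f H = compose H h \<alpha>}"
        using T_Hom iff by auto
      show "{f \<in> Hom G K. restrict f H = compose H h \<alpha>} \<subseteq> T ` {f \<in> Hom G K. restrict f (\<alpha> ` H) = h}"
      proof
        fix f' assume f': "f' \<in> {f \<in> Hom G K. restrict f H = compose H h \<alpha>}"
        then have "f' \<in> T ` Hom G K" using surj_T by simp
        then obtain f where "f \<in> Hom G K" "f' = T f" by auto
        then show "f' \<in> T ` {f \<in> Hom G K. restrict f (\<alpha> ` H) = h}" using f' iff by auto
      qed
    qed
    have "inj_on T {f \<in> Hom G K. restrict f (\<alpha> ` H) = h}"
      by (rule inj_on_subset[OF inj_T]) auto
    from card_image[OF this] image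
    have "card {f \<in> Hom G K. restrict f (\<alpha> ` H) = h}
        = card {f \<in> Hom G K. restrict f H = compose H h \<alpha>}" by simp
    then show ?thesis by (simp add: Pr_def)
  qed
  ultimately show ?thesis
    using H \<alpha>_iso by (simp add: measure_equivalence_def)
qed

end

theorem corollary2p3:
  fixes G :: "('a, 'b) monoid_scheme" and H :: "'a set"
  assumes "group G"
    and "fg_subgroup G (carrier G)"
    and "LERF G"
    and "fg_subgroup G H"
  shows "(profinitely_rigid G H \<longleftrightarrow>
            (\<forall>\<Theta> \<in> continuous_auto G.
               \<Theta> ` to_completion G ` H \<subseteq> to_completion G ` carrier G \<longrightarrow>
               (\<exists>\<phi> \<in> auto G. \<forall>h \<in> H. to_completion G (\<phi> h) = \<Theta> (to_completion G h)))) \<and>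
         (setwise_profinitely_rigid G H \<longleftrightarrow>
            (\<forall>\<Theta> \<in> continuous_auto G.
               \<Theta> ` to_completion G ` H \<subseteq> to_completion G ` carrier G \<longrightarrow>
               (\<exists>\<phi> \<in> auto G. \<Theta> ` to_completion G ` H = to_completion G ` \<phi> ` H)))"
proof -
  interpret group G by fact
  note fg = assms(2) and lerf = assms(3) and H = assms(4)
  let ?\<iota> = "to_completion G"
  have HG: "H \<subseteq> carrier G"
    using H generate_incl by (auto simp: fg_subgroup_def)
  have inj: "inj_on ?\<iota> (carrier G)" by (rule inj_on_to_completion[OF is_group lerf])
  have auto_closed: "\<phi> x \<in> carrier G" if "\<phi> \<in> auto G" "x \<in> carrier G" for \<phi> x
    using that hom_in_carrier[of \<phi> G G x] by (simp add: auto_def)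
  have restricts: "\<exists>\<alpha>. measure_equivalence G H (\<alpha> ` H) \<alpha> \<and> fg_subgroup G (\<alpha> ` H) \<and>
      (\<forall>x \<in> H. ?\<iota> (\<alpha> x) = \<Theta> (?\<iota> x))"
    if "\<Theta> \<in> continuous_auto G" "\<Theta> ` ?\<iota> ` H \<subseteq> ?\<iota> ` carrier G" for \<Theta>
  proof -
    have "\<exists>g. g \<in> carrier G \<and> ?\<iota> g = \<Theta> (?\<iota> x)" if "x \<in> H" for x
    proof -
      have "\<Theta> (?\<iota> x) \<in> ?\<iota> ` carrier G"
        using \<open>\<Theta> ` ?\<iota> ` H \<subseteq> ?\<iota> ` carrier G\<close> that by auto
      then show ?thesis by (auto simp: image_iff)
    qed
    then obtain \<alpha> where \<alpha>: "\<And>x. x \<in> H \<Longrightarrow> \<alpha> x \<in> carrier G \<and> ?\<iota> (\<alpha> x) = \<Theta> (?\<iota> x)" by metis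
    from continuous_auto_restricts_to_measure_equivalence[OF fg lerf H that(1) this]
    show ?thesis using \<alpha> by (auto simp: measure_equivalence_def)
  qed
  have extends: "\<exists>\<Theta> \<in> continuous_auto G. \<Theta> ` ?\<iota> ` H \<subseteq> ?\<iota> ` carrier G \<and>
      (\<forall>x \<in> H. \<Theta> (?\<iota> x) = ?\<iota> (\<alpha> x)) \<and> \<alpha> ` H = L \<and> L \<subseteq> carrier G"
    if me: "measure_equivalence G H L \<alpha>" for L \<alpha>
  proof -
    obtain \<Theta> where \<Theta>: "\<Theta> \<in> continuous_auto G" "\<And>x. x \<in> H \<Longrightarrow> \<Theta> (?\<iota> x) = ?\<iota> (\<alpha> x)"
      using measure_equivalence_extends[OF fg me] by metis
    have L: "\<alpha> ` H = L" "L \<subseteq> carrier G"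
      using me generate_incl by (auto simp: measure_equivalence_def fg_subgroup_def iso_def bij_betw_def)
    then have "\<Theta> ` ?\<iota> ` H \<subseteq> ?\<iota> ` carrier G" using \<Theta>(2) by auto
    then show ?thesis using \<Theta> L by blast
  qed
  have rigid: "profinitely_rigid G H \<longleftrightarrow>
      (\<forall>\<Theta> \<in> continuous_auto G. \<Theta> ` ?\<iota> ` H \<subseteq> ?\<iota> ` carrier G \<longrightarrow>
         (\<exists>\<phi> \<in> auto G. \<forall>h \<in> H. ?\<iota> (\<phi> h) = \<Theta> (?\<iota> h)))" (is "_ \<longleftrightarrow> ?R")
  proof
    assume r: "profinitely_rigid G H"
    show ?R
    proof (intro ballI impI)
      fix \<Theta> assume "\<Theta> \<in> continuous_auto G" "\<Theta> ` ?\<iota> ` H \<subseteq> ?\<iota> ` carrier G"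
      from restricts[OF this] obtain \<alpha> where \<alpha>: "measure_equivalence G H (\<alpha> ` H) \<alpha>"
          "fg_subgroup G (\<alpha> ` H)" "\<And>x. x \<in> H \<Longrightarrow> ?\<iota> (\<alpha> x) = \<Theta> (?\<iota> x)" by metis
      then obtain \<phi> where "\<phi> \<in> auto G" "\<And>h. h \<in> H \<Longrightarrow> \<phi> h = \<alpha> h"
        using r unfolding profinitely_rigid_def by metis
      then show "\<exists>\<phi> \<in> auto G. \<forall>h \<in> H. ?\<iota> (\<phi> h) = \<Theta> (?\<iota> h)" using \<alpha>(3) by metis
    qed
  next
    assume R: ?R
    show "profinitely_rigid G H"
      unfolding profinitely_rigid_def
    proof (intro allI impI, elim conjE)
      fix L \<alpha> assume "measure_equivalence G H L \<alpha>"
      from extends[OF this] obtain \<Theta> where \<Theta>: "\<Theta> \<in> continuous_auto G"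
        "\<Theta> ` ?\<iota> ` H \<subseteq> ?\<iota> ` carrier G" "\<And>x. x \<in> H \<Longrightarrow> \<Theta> (?\<iota> x) = ?\<iota> (\<alpha> x)"
        and L: "\<alpha> ` H = L" "L \<subseteq> carrier G" by metis
      then obtain \<phi> where \<phi>: "\<phi> \<in> auto G" "\<And>h. h \<in> H \<Longrightarrow> ?\<iota> (\<phi> h) = \<Theta> (?\<iota> h)"
        using R by metis
      have eq: "\<phi> h = \<alpha> h" if h: "h \<in> H" for h
      proof (rule inj_onD[OF inj])
        show "?\<iota> (\<phi> h) = ?\<iota> (\<alpha> h)" using \<phi>(2)[OF h] \<Theta>(3)[OF h] by simp
        show "\<phi> h \<in> carrier G" using auto_closed \<phi>(1) HG h by blast
        show "\<alpha> h \<in> carrier G" using L h by blast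
      qed
      then have "\<phi> ` H = L" using L(1) by auto
      then show "\<exists>\<phi> \<in> auto G. \<phi> ` H = L \<and> (\<forall>h \<in> H. \<phi> h = \<alpha> h)" using \<phi>(1) eq by blast
    qed
  qed
  moreover have "setwise_profinitely_rigid G H \<longleftrightarrow>
      (\<forall>\<Theta> \<in> continuous_auto G. \<Theta> ` ?\<iota> ` H \<subseteq> ?\<iota> ` carrier G \<longrightarrow>
         (\<exists>\<phi> \<in> auto G. \<Theta> ` ?\<iota> ` H = ?\<iota> ` \<phi> ` H))" (is "_ \<longleftrightarrow> ?R")
  proof
    assume r: "setwise_profinitely_rigid G H"
    show ?R
    proof (intro ballI impI)
      fix \<Theta> assume "\<Theta> \<in> continuous_auto G" "\<Theta> ` ?\<iota> ` H \<subseteq> ?\<iota> ` carrier G"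
      from restricts[OF this] obtain \<alpha> where \<alpha>: "measure_equivalence G H (\<alpha> ` H) \<alpha>"
          "fg_subgroup G (\<alpha> ` H)" "\<And>x. x \<in> H \<Longrightarrow> ?\<iota> (\<alpha> x) = \<Theta> (?\<iota> x)" by metis
      then obtain \<phi> where \<phi>: "\<phi> \<in> auto G" "\<alpha> ` H = \<phi> ` H"
        using r unfolding setwise_profinitely_rigid_def measure_equivalent_def by metis
      have "\<Theta> ` ?\<iota> ` H = ?\<iota> ` \<alpha> ` H" using \<alpha>(3) by (simp add: image_image)
      then show "\<exists>\<phi> \<in> auto G. \<Theta> ` ?\<iota> ` H = ?\<iota> ` \<phi> ` H" using \<phi> by metis
    qed
  next
    assume R: ?R
    show "setwise_profinitely_rigid G H"
      unfolding setwise_profinitely_rigid_def measure_equivalent_def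
    proof (intro allI impI, elim conjE exE)
      fix L \<alpha> assume "measure_equivalence G H L \<alpha>"
      from extends[OF this] obtain \<Theta> where \<Theta>: "\<Theta> \<in> continuous_auto G"
        "\<Theta> ` ?\<iota> ` H \<subseteq> ?\<iota> ` carrier G" "\<And>x. x \<in> H \<Longrightarrow> \<Theta> (?\<iota> x) = ?\<iota> (\<alpha> x)"
        and L: "\<alpha> ` H = L" "L \<subseteq> carrier G" by metis
      then obtain \<phi> where \<phi>: "\<phi> \<in> auto G" "\<Theta> ` ?\<iota> ` H = ?\<iota> ` \<phi> ` H"
        using R by metis
      have "?\<iota> ` L = \<Theta> ` ?\<iota> ` H" using \<Theta>(3) L(1) by (auto simp: image_image)
      then have "?\<iota> ` L = ?\<iota> ` \<phi> ` H" using \<phi>(2) by simp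
      moreover have "\<phi> ` H \<subseteq> carrier G" using auto_closed \<phi>(1) HG by blast
      ultimately have "L = \<phi> ` H" using inj_on_image_eq_iff[OF inj L(2)] by simp
      then show "\<exists>\<phi> \<in> auto G. L = \<phi> ` H" using \<phi>(1) by blast
    qed
  qed
  ultimately show ?thesis by (rule conjI)
qed

end
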